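(* Let $\mathcal I$ be an ideal on $\mathbb N$. The following statements are equivalent: (1) $K_{\mathcal I}$ is homeomorphic to $\beta\mathbb N$; (2) $\ell_\infty/c_{0,\mathcal I}$ is isometric to $\ell_\infty$; (3) $\ell_\infty/c_{0,\mathcal I}$ is Banach lattice isomorphic to $\ell_\infty$; (4) $\mathcal I$ is strongly $\omega$-maximal; (5) $\mathcal I$ is strongly complemented.
   Context: An ideal on $\mathbb N$ is a family of subsets of $\mathbb N$ containing $\emptyset$ and closed under subsets and finite unions; every ideal is assumed to contain all finite sets. A maximal ideal is a proper ideal whose only proper extension is $\mathcal P(\mathbb N)$. The dual filter of $\mathcal I$ is $\mathcal I^*=\{\mathbb N\setminus A:A\in\mathcal I\}$. $\beta\mathbb N$ is the Stone–Čech compactification of $\mathbb N$, identified with the space of all ultrafilters on $\mathbb N$ with basic open sets $\{p:A\in p\}$, $A\subseteq\mathbb N$. $K_{\mathcal I}=\{p\in\beta\mathbb N:\mathcal I^*\subseteq p\}$ with the subspace topology. $\mathcal I$ is strongly $\omega$-maximal if there is a countably infinite collection $\{\mathcal I_n:n\in\mathbb N\}$ of maximal ideals on $\mathbb N$ with $\mathcal I=\bigcap_n\mathcal I_n$ such that $\{\mathcal I_n^*:n\in\mathbb N\}$ is a discrete subspace of $\beta\mathbb N$. $\ell_\infty$ is the real Banach lattice of bounded real sequences (sup norm, coordinatewise order), and $c_{0,\mathcal I}$ is the closed subspace of all $(x_n)\in\ell_\infty$ with $\{n:|x_n|\ge\varepsilon\}\in\mathcal I$ for every $\varepsilon>0$;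 $\ell_\infty/c_{0,\mathcal I}$ has the quotient Banach lattice structure. "Isometric" means linearly isometrically isomorphic; "Banach lattice isomorphic" means there is a bijective bounded linear operator preserving the lattice operations. An $\mathcal I$-discrete projection is a positive projection $Q\colon\ell_\infty\to\ell_\infty$ (bounded linear, $Q^2=Q$, $Qx\ge 0$ whenever $x\ge0$) with $\ker Q=c_{0,\mathcal I}$ such that: for each $A\subseteq\mathbb N$ there is $T(A)\subseteq\mathbb N$ with $Q(\chi_A)=\chi_{T(A)}$; $T(A\cap B)=T(A)\cap T(B)$ for all $A,B\subseteq\mathbb N$; and the family $\{B\subseteq\mathbb N:T(B)=B\}$ is closed under arbitrary intersections (including the empty intersection, which is $\mathbb N$). $\mathcal I$ is strongly complemented if there is an $\mathcal I$-discrete projection of infinite rank. *)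

theory Defs
  imports "HOL-Analysis.Analysis"
begin

section \<open>Ideals and ultrafilters on the natural numbers\<close>

text \<open>An ideal contains all finite sets but need not be proper.\<close>

definition nat_ideal :: "nat set set \<Rightarrow> bool" where
  "nat_ideal I \<longleftrightarrow>
     {} \<in> I \<and>
     (\<forall>A B. A \<in> I \<longrightarrow> B \<subseteq> A \<longrightarrow> B \<in> I) \<and>
     (\<forall>A B. A \<in> I \<longrightarrow> B \<in> I \<longrightarrow> A \<union> B \<in> I) \<and>
     (\<forall>A. finite A \<longrightarrow> A \<in> I)"

definition maximal_nat_ideal :: "nat set set \<Rightarrow> bool" where
  "maximal_nat_ideal J \<longleftrightarrow>
     nat_ideal J \<and> J \<noteq> UNIV \<and> (\<forall>J'. nat_ideal J' \<longrightarrow> J \<subset> J' \<longrightarrow> J' = UNIV)"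

definition dual_filter :: "nat set set \<Rightarrow> nat set set" where
  "dual_filter I = {UNIV - A | A. A \<in> I}"

definition nat_ultrafilter :: "nat set set \<Rightarrow> bool" where
  "nat_ultrafilter p \<longleftrightarrow>
     UNIV \<in> p \<and> {} \<notin> p \<and>
     (\<forall>A B. A \<in> p \<longrightarrow> A \<subseteq> B \<longrightarrow> B \<in> p) \<and>
     (\<forall>A B. A \<in> p \<longrightarrow> B \<in> p \<longrightarrow> A \<inter> B \<in> p) \<and>
     (\<forall>A. A \<in> p \<or> UNIV - A \<in> p)"

definition beta_nat :: "nat set set topology" where
  "beta_nat = topology_generated_by (range (\<lambda>A. {p. nat_ultrafilter p \<and> A \<in> p}))"

lemma topspace_beta_nat: "topspace beta_nat = {p. nat_ultrafilter p}"
  unfolding beta_nat_def topology_generated_by_topspace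
  by (auto simp: nat_ultrafilter_def)

definition K_space :: "nat set set \<Rightarrow> nat set set topology" where
  "K_space I = subtopology beta_nat {p. nat_ultrafilter p \<and> dual_filter I \<subseteq> p}"

definition strongly_omega_maximal :: "nat set set \<Rightarrow> bool" where
  "strongly_omega_maximal I \<longleftrightarrow>
     (\<exists>M. countable M \<and> infinite M \<and> (\<forall>J\<in>M. maximal_nat_ideal J) \<and> I = \<Inter>M \<and>
          subtopology beta_nat (dual_filter ` M) = discrete_topology (dual_filter ` M))"

section \<open>The Banach lattice of bounded sequences\<close>

text \<open>As \<^typ>\<open>nat\<close> carries the discrete topology, every bounded sequence is a bounded
  continuous function; the library norm on this type is the sup norm.\<close>

type_synonym linf = "nat \<Rightarrow>\<^sub>C real"

lemma bounded_seq_in_bcontfun: "bounded (range f) \<Longrightarrow> f \<in> bcontfun"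
  for f :: "nat \<Rightarrow> real"
  by (simp add: bcontfun_def)

definition linf_sup :: "linf \<Rightarrow> linf \<Rightarrow> linf" where
  "linf_sup x y = Bcontfun (\<lambda>n. max (apply_bcontfun x n) (apply_bcontfun y n))"

definition linf_inf :: "linf \<Rightarrow> linf \<Rightarrow> linf" where
  "linf_inf x y = Bcontfun (\<lambda>n. min (apply_bcontfun x n) (apply_bcontfun y n))"

definition chi :: "nat set \<Rightarrow> linf" where
  "chi A = Bcontfun (indicator A)"

lemma linf_sup_apply: "apply_bcontfun (linf_sup x y) n = max (apply_bcontfun x n) (apply_bcontfun y n)"
  and linf_inf_apply: "apply_bcontfun (linf_inf x y) n = min (apply_bcontfun x n) (apply_bcontfun y n)"
proof -
  obtain a b where ab: "\<And>n. \<bar>apply_bcontfun x n\<bar> \<le> a" "\<And>n. \<bar>apply_bcontfun y n\<bar> \<le> b"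
    using bounded_apply_bcontfun[of x] bounded_apply_bcontfun[of y]
    by (auto simp: bounded_iff simp del: bounded_apply_bcontfun)
  have *: "\<bar>max (apply_bcontfun x n) (apply_bcontfun y n)\<bar> \<le> max a b"
    "\<bar>min (apply_bcontfun x n) (apply_bcontfun y n)\<bar> \<le> max a b" for n
    using ab(1)[of n] ab(2)[of n] by linarith+
  have "(\<lambda>n. max (apply_bcontfun x n) (apply_bcontfun y n)) \<in> bcontfun"
    by (rule bounded_seq_in_bcontfun) (use *(1) in \<open>auto simp: bounded_iff intro!: exI[of _ "max a b"]\<close>)
  then show "apply_bcontfun (linf_sup x y) n = max (apply_bcontfun x n) (apply_bcontfun y n)"
    by (simp add: linf_sup_def Bcontfun_inverse)
  have "(\<lambda>n. min (apply_bcontfun x n) (apply_bcontfun y n)) \<in> bcontfun"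
    by (rule bounded_seq_in_bcontfun) (use *(2) in \<open>auto simp: bounded_iff intro!: exI[of _ "max a b"]\<close>)
  then show "apply_bcontfun (linf_inf x y) n = min (apply_bcontfun x n) (apply_bcontfun y n)"
    by (simp add: linf_inf_def Bcontfun_inverse)
qed

lemma chi_apply: "apply_bcontfun (chi A) n = indicator A n"
proof -
  have "(indicator A :: nat \<Rightarrow> real) \<in> bcontfun"
    by (rule bounded_seq_in_bcontfun) (auto simp: bounded_iff indicator_def intro!: exI[of _ 1])
  then show ?thesis by (simp add: chi_def Bcontfun_inverse)
qed

definition linf_nonneg :: "linf \<Rightarrow> bool" where
  "linf_nonneg x \<longleftrightarrow> (\<forall>n. 0 \<le> apply_bcontfun x n)"

definition c0 :: "nat set set \<Rightarrow> linf set" where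
  "c0 I = {x. \<forall>e>0. {n. \<bar>apply_bcontfun x n\<bar> \<ge> e} \<in> I}"

section \<open>The quotient Banach lattice\<close>

definition c0_rel :: "nat set set \<Rightarrow> (linf \<times> linf) set" where
  "c0_rel I = {(x, y). x - y \<in> c0 I}"

definition quot :: "nat set set \<Rightarrow> linf set set" where
  "quot I = UNIV // c0_rel I"

text \<open>The operations below are computed on representatives; the unions are over equal cosets.\<close>

definition quot_add :: "nat set set \<Rightarrow> linf set \<Rightarrow> linf set \<Rightarrow> linf set" where
  "quot_add I X Y = (\<Union>x\<in>X. \<Union>y\<in>Y. c0_rel I `` {x + y})"

definition quot_scale :: "nat set set \<Rightarrow> real \<Rightarrow> linf set \<Rightarrow> linf set" where
  "quot_scale I c X = (\<Union>x\<in>X. c0_rel I `` {c *\<^sub>R x})"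

definition quot_sup :: "nat set set \<Rightarrow> linf set \<Rightarrow> linf set \<Rightarrow> linf set" where
  "quot_sup I X Y = (\<Union>x\<in>X. \<Union>y\<in>Y. c0_rel I `` {linf_sup x y})"

definition quot_inf :: "nat set set \<Rightarrow> linf set \<Rightarrow> linf set \<Rightarrow> linf set" where
  "quot_inf I X Y = (\<Union>x\<in>X. \<Union>y\<in>Y. c0_rel I `` {linf_inf x y})"

definition quot_norm :: "linf set \<Rightarrow> real" where
  "quot_norm X = (INF x\<in>X. norm x)"

lemma c0_dominated:
  assumes I: "nat_ideal I" and "x \<in> c0 I" "y \<in> c0 I"
    and le: "\<And>n. \<bar>apply_bcontfun z n\<bar> \<le> \<bar>apply_bcontfun x n\<bar> + \<bar>apply_bcontfun y n\<bar>"
  shows "z \<in> c0 I"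
  unfolding c0_def
proof (intro CollectI allI impI)
  fix e :: real assume "e > 0"
  then have "{n. \<bar>apply_bcontfun x n\<bar> \<ge> e/2} \<in> I" "{n. \<bar>apply_bcontfun y n\<bar> \<ge> e/2} \<in> I"
    using assms(2,3) half_gt_zero[of e] unfolding c0_def by blast+
  then have U: "{n. \<bar>apply_bcontfun x n\<bar> \<ge> e/2} \<union> {n. \<bar>apply_bcontfun y n\<bar> \<ge> e/2} \<in> I"
    using I by (simp add: nat_ideal_def)
  have "{n. \<bar>apply_bcontfun z n\<bar> \<ge> e} \<subseteq>
      {n. \<bar>apply_bcontfun x n\<bar> \<ge> e/2} \<union> {n. \<bar>apply_bcontfun y n\<bar> \<ge> e/2}"
  proof
    fix n assume "n \<in> {n. \<bar>apply_bcontfun z n\<bar> \<ge> e}"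
    with le[of n]
    show "n \<in> {n. \<bar>apply_bcontfun x n\<bar> \<ge> e/2} \<union> {n. \<bar>apply_bcontfun y n\<bar> \<ge> e/2}"
      by auto
  qed
  with U I show "{n. \<bar>apply_bcontfun z n\<bar> \<ge> e} \<in> I"
    unfolding nat_ideal_def by blast
qed

lemma c0_zero: "nat_ideal I \<Longrightarrow> 0 \<in> c0 I"
  by (auto simp: c0_def nat_ideal_def)

lemma c0_scale:
  assumes I: "nat_ideal I" and x: "x \<in> c0 I"
  shows "c *\<^sub>R x \<in> c0 I"
proof (cases "c = 0")
  case True
  then show ?thesis using c0_zero[OF I] by simp
next
  case False
  show ?thesis unfolding c0_def
  proof (intro CollectI allI impI)
    fix e :: real assume "e > 0"
    then have "{n. \<bar>apply_bcontfun x n\<bar> \<ge> e / \<bar>c\<bar>} \<in> I"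
      using x False by (auto simp: c0_def)
    also have "{n. \<bar>apply_bcontfun x n\<bar> \<ge> e / \<bar>c\<bar>} = {n. \<bar>apply_bcontfun (c *\<^sub>R x) n\<bar> \<ge> e}"
      using False by (auto simp: abs_mult field_simps)
    finally show "{n. \<bar>apply_bcontfun (c *\<^sub>R x) n\<bar> \<ge> e} \<in> I" .
  qed
qed

lemma equiv_c0_rel:
  assumes I: "nat_ideal I"
  shows "equiv UNIV (c0_rel I)"
proof (rule equivI)
  show "c0_rel I \<subseteq> UNIV \<times> UNIV" by simp
  show "refl (c0_rel I)"
    using c0_zero[OF I] by (auto simp: refl_on_def c0_rel_def)
  show "sym (c0_rel I)"
  proof (rule symI)
    fix x y assume "(x, y) \<in> c0_rel I"
    then show "(y, x) \<in> c0_rel I"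
      unfolding c0_rel_def by (auto intro!: c0_dominated[OF I, of "x - y" 0] c0_zero[OF I])
  qed
  show "trans (c0_rel I)"
  proof (rule transI)
    fix x y z assume "(x, y) \<in> c0_rel I" "(y, z) \<in> c0_rel I"
    then show "(x, z) \<in> c0_rel I"
      unfolding c0_rel_def using c0_dominated[OF I, of "x - y" "y - z" "x - z"] by auto
  qed
qed

lemma quot_ops_class:
  assumes I: "nat_ideal I"
  shows "quot_add I (c0_rel I `` {x}) (c0_rel I `` {y}) = c0_rel I `` {x + y}"
    and "quot_scale I c (c0_rel I `` {x}) = c0_rel I `` {c *\<^sub>R x}"
    and "quot_sup I (c0_rel I `` {x}) (c0_rel I `` {y}) = c0_rel I `` {linf_sup x y}"
    and "quot_inf I (c0_rel I `` {x}) (c0_rel I `` {y}) = c0_rel I `` {linf_inf x y}"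
proof -
  note E = equiv_c0_rel[OF I]
  have "congruent2 (c0_rel I) (c0_rel I) (\<lambda>x y. c0_rel I `` {x + y})"
  proof (rule congruent2I')
    fix x x' y y' assume "(x, x') \<in> c0_rel I" "(y, y') \<in> c0_rel I"
    then have "(x + y, x' + y') \<in> c0_rel I"
      unfolding c0_rel_def
      using c0_dominated[OF I, of "x - x'" "y - y'" "(x + y) - (x' + y')"] by auto
    then show "c0_rel I `` {x + y} = c0_rel I `` {x' + y'}" by (rule equiv_class_eq[OF E])
  qed
  from UN_equiv_class2[OF E E this] show
    "quot_add I (c0_rel I `` {x}) (c0_rel I `` {y}) = c0_rel I `` {x + y}"
    by (simp add: quot_add_def)
  have "congruent2 (c0_rel I) (c0_rel I) (\<lambda>x y. c0_rel I `` {linf_sup x y})"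
  proof (rule congruent2I')
    fix x x' y y' assume "(x, x') \<in> c0_rel I" "(y, y') \<in> c0_rel I"
    then have "(linf_sup x y, linf_sup x' y') \<in> c0_rel I"
      unfolding c0_rel_def
      by (auto simp: linf_sup_apply intro!: c0_dominated[OF I, of "x - x'" "y - y'"])
    then show "c0_rel I `` {linf_sup x y} = c0_rel I `` {linf_sup x' y'}"
      by (rule equiv_class_eq[OF E])
  qed
  from UN_equiv_class2[OF E E this] show
    "quot_sup I (c0_rel I `` {x}) (c0_rel I `` {y}) = c0_rel I `` {linf_sup x y}"
    by (simp add: quot_sup_def)
  have "congruent2 (c0_rel I) (c0_rel I) (\<lambda>x y. c0_rel I `` {linf_inf x y})"
  proof (rule congruent2I')
    fix x x' y y' assume "(x, x') \<in> c0_rel I" "(y, y') \<in> c0_rel I"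
    then have "(linf_inf x y, linf_inf x' y') \<in> c0_rel I"
      unfolding c0_rel_def
      by (auto simp: linf_inf_apply intro!: c0_dominated[OF I, of "x - x'" "y - y'"])
    then show "c0_rel I `` {linf_inf x y} = c0_rel I `` {linf_inf x' y'}"
      by (rule equiv_class_eq[OF E])
  qed
  from UN_equiv_class2[OF E E this] show
    "quot_inf I (c0_rel I `` {x}) (c0_rel I `` {y}) = c0_rel I `` {linf_inf x y}"
    by (simp add: quot_inf_def)
  have "congruent (c0_rel I) (\<lambda>x. c0_rel I `` {c *\<^sub>R x})"
  proof (rule congruentI)
    fix x x' assume "(x, x') \<in> c0_rel I"
    then have "(c *\<^sub>R x, c *\<^sub>R x') \<in> c0_rel I"
      unfolding c0_rel_def using c0_scale[OF I, of "x - x'" c] by (simp add: scaleR_diff_right)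
    then show "c0_rel I `` {c *\<^sub>R x} = c0_rel I `` {c *\<^sub>R x'}" by (rule equiv_class_eq[OF E])
  qed
  from UN_equiv_class[OF E this] show
    "quot_scale I c (c0_rel I `` {x}) = c0_rel I `` {c *\<^sub>R x}"
    by (simp add: quot_scale_def)
qed

definition quot_linear :: "nat set set \<Rightarrow> (linf set \<Rightarrow> linf) \<Rightarrow> bool" where
  "quot_linear I T \<longleftrightarrow>
     (\<forall>X\<in>quot I. \<forall>Y\<in>quot I. T (quot_add I X Y) = T X + T Y) \<and>
     (\<forall>c. \<forall>X\<in>quot I. T (quot_scale I c X) = c *\<^sub>R T X)"

definition quot_isometric_linf :: "nat set set \<Rightarrow> bool" where
  "quot_isometric_linf I \<longleftrightarrow>
     (\<exists>T. bij_betw T (quot I) UNIV \<and> quot_linear I T \<and>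
          (\<forall>X\<in>quot I. norm (T X) = quot_norm X))"

definition quot_lattice_isomorphic_linf :: "nat set set \<Rightarrow> bool" where
  "quot_lattice_isomorphic_linf I \<longleftrightarrow>
     (\<exists>T. bij_betw T (quot I) UNIV \<and> quot_linear I T \<and>
          (\<exists>C. \<forall>X\<in>quot I. norm (T X) \<le> C * quot_norm X) \<and>
          (\<forall>X\<in>quot I. \<forall>Y\<in>quot I. T (quot_sup I X Y) = linf_sup (T X) (T Y)) \<and>
          (\<forall>X\<in>quot I. \<forall>Y\<in>quot I. T (quot_inf I X Y) = linf_inf (T X) (T Y)))"

section \<open>Discrete projections\<close>

definition discrete_projection :: "nat set set \<Rightarrow> (linf \<Rightarrow> linf) \<Rightarrow> bool" where
  "discrete_projection I Q \<longleftrightarrow>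
     bounded_linear Q \<and> (\<forall>x. Q (Q x) = Q x) \<and>
     (\<forall>x. linf_nonneg x \<longrightarrow> linf_nonneg (Q x)) \<and>
     {x. Q x = 0} = c0 I \<and>
     (\<exists>T :: nat set \<Rightarrow> nat set.
        (\<forall>A. Q (chi A) = chi (T A)) \<and>
        (\<forall>A B. T (A \<inter> B) = T A \<inter> T B) \<and>
        (\<forall>F. F \<subseteq> {B. T B = B} \<longrightarrow> \<Inter>F \<in> {B. T B = B}))"

definition infinite_rank :: "(linf \<Rightarrow> linf) \<Rightarrow> bool" where
  "infinite_rank Q \<longleftrightarrow> \<not> (\<exists>B. finite B \<and> range Q \<subseteq> span B)"

definition strongly_complemented :: "nat set set \<Rightarrow> bool" where
  "strongly_complemented I \<longleftrightarrow> (\<exists>Q. discrete_projection I Q \<and> infinite_rank Q)"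

end

theory Submission
  imports Defs
begin

text \<open>
  All five conditions say that the ideal consists of the common null sets of a discrete sequence of
  ultrafilters. The hub of the proof is this condition, \<open>discrete_ultrafilter_family\<close>, which is
  strong \<open>\<omega>\<close>-maximality up to the duality of maximal ideals and ultrafilters. A countable
  discrete family of ultrafilters can be separated by pairwise disjoint sets, that is, by the fibres
  of one map \<open>c\<close> on the natural numbers (\<open>discrete_family_imp_separated\<close>).

  With such a map everything is explicit. The limits along the ultrafilters form an operator on
  the bounded sequences whose kernel is the kernel of the quotient map; composition with \<open>c\<close>
  is an isometric right inverse, so this operator induces an isometric lattice isomorphism of
  the quotient. Limits followed by composition with \<open>c\<close> form the discrete projection. On the
  side of ultrafilters, pushing forward along \<open>c\<close> maps the space above the dual filter onto the
  space of all ultrafilters, and the inverse sends an ultrafilter on the indices to the limit of the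
  family along it.

  Conversely, each condition exhibits the family. A homeomorphism carries the principal ultrafilters,
  which are isolated and dense, to it. If a discrete projection acts on indicators by the set map
  \<open>T\<close>, it assigns to \<open>k\<close> the ultrafilter of all \<open>A\<close> with \<open>k \<in> T A\<close>, and the atoms of the
  algebra of sets fixed by \<open>T\<close> isolate these ultrafilters; infinite rank makes infinitely many of
  them distinct. A lattice isomorphism is a
  sequence of lattice homomorphisms to the reals, each carried by an ultrafilter, and preimages of
  the unit vectors isolate them. An isometry reduces to this case by the argument of the
  Banach-Stone theorem: the image of the unit is an extreme point of the unit ball, hence a sequence
  of signs; after multiplication by these signs the isometry preserves the unit, therefore the order,
  and therefore absolute values.
\<close>

section \<open>Ultrafilters and maximal ideals\<close>

lemma ultrafilter_superset: "nat_ultrafilter p \<Longrightarrow> A \<in> p \<Longrightarrow> A \<subseteq> B \<Longrightarrow> B \<in> p"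
  and ultrafilter_empty: "nat_ultrafilter p \<Longrightarrow> {} \<notin> p"
  and ultrafilter_UNIV: "nat_ultrafilter p \<Longrightarrow> UNIV \<in> p"
  and ultrafilter_Int_intro: "nat_ultrafilter p \<Longrightarrow> A \<in> p \<Longrightarrow> B \<in> p \<Longrightarrow> A \<inter> B \<in> p"
  unfolding nat_ultrafilter_def by blast+

lemma ultrafilter_Int_iff: "nat_ultrafilter p \<Longrightarrow> A \<inter> B \<in> p \<longleftrightarrow> A \<in> p \<and> B \<in> p"
  by (meson inf_le1 inf_le2 ultrafilter_Int_intro ultrafilter_superset)

lemma ultrafilter_Compl_iff: "nat_ultrafilter p \<Longrightarrow> - A \<in> p \<longleftrightarrow> A \<notin> p"
  by (metis Compl_disjoint Compl_eq_Diff_UNIV nat_ultrafilter_def)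

lemma ultrafilter_Un_iff:
  assumes "nat_ultrafilter p"
  shows "A \<union> B \<in> p \<longleftrightarrow> A \<in> p \<or> B \<in> p"
proof -
  have "- A \<inter> - B \<in> p \<longleftrightarrow> A \<notin> p \<and> B \<notin> p"
    by (simp only: ultrafilter_Int_iff[OF assms] ultrafilter_Compl_iff[OF assms])
  then show ?thesis
    using ultrafilter_Compl_iff[OF assms, of "A \<union> B"] by (simp only: Compl_Un) blast
qed

lemma ultrafilter_UN_finite:
  assumes "nat_ultrafilter p" and "finite S" and "\<And>i. i \<in> S \<Longrightarrow> A i \<notin> p"
  shows "(\<Union>i\<in>S. A i) \<notin> p"
  using assms(2,3)
  by (induction) (auto simp: ultrafilter_empty[OF assms(1)] ultrafilter_Un_iff[OF assms(1)])

lemma ultrafilter_principal: "nat_ultrafilter {A. n \<in> A}"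
  by (auto simp: nat_ultrafilter_def)

lemma ideal_subset: "nat_ideal I \<Longrightarrow> A \<in> I \<Longrightarrow> B \<subseteq> A \<Longrightarrow> B \<in> I"
  and ideal_Un: "nat_ideal I \<Longrightarrow> A \<in> I \<Longrightarrow> B \<in> I \<Longrightarrow> A \<union> B \<in> I"
  and ideal_empty: "nat_ideal I \<Longrightarrow> {} \<in> I"
  and ideal_finite: "nat_ideal I \<Longrightarrow> finite A \<Longrightarrow> A \<in> I"
  unfolding nat_ideal_def by blast+

lemma proper_ideal_iff: "nat_ideal I \<Longrightarrow> I \<noteq> UNIV \<longleftrightarrow> UNIV \<notin> I"
  by (metis UNIV_eq_I UNIV_I ideal_subset subset_UNIV)

lemma nat_ideal_trace:
  assumes I: "nat_ideal I"
  shows "nat_ideal {B. A \<inter> B \<in> I}"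
  unfolding nat_ideal_def
proof (intro conjI allI impI)
  show "C \<in> {B. A \<inter> B \<in> I}" if "B \<in> {B. A \<inter> B \<in> I}" "C \<subseteq> B" for B C
    using that ideal_subset[OF I, of "A \<inter> B" "A \<inter> C"] by blast
qed (auto simp: ideal_empty[OF I] ideal_finite[OF I] Int_Un_distrib intro: ideal_Un[OF I])

lemma dual_filter_iff: "A \<in> dual_filter I \<longleftrightarrow> - A \<in> I"
  unfolding dual_filter_def Compl_eq_Diff_UNIV by (auto simp: double_diff)

lemma dual_filter_subset_iff:
  assumes "nat_ultrafilter p"
  shows "dual_filter I \<subseteq> p \<longleftrightarrow> I \<subseteq> - p"
  unfolding subset_iff dual_filter_iff
  by (metis ComplI ComplD double_complement ultrafilter_Compl_iff[OF assms])

text \<open>The sets that meet \<open>A\<close> in a member of the maximal ideal \<open>J\<close> form an ideal that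
  extends \<open>J\<close> and contains the complement of \<open>A\<close>. If this ideal is \<open>J\<close>, the complement is
  in \<open>J\<close>; if it is everything, \<open>A\<close> is in \<open>J\<close>.\<close>

lemma maximal_ideal_dual:
  assumes J: "maximal_nat_ideal J"
  shows "dual_filter J = - J" and "nat_ultrafilter (- J)"
proof -
  have ideal: "nat_ideal J" and "J \<noteq> UNIV"
    and max: "\<And>J'. nat_ideal J' \<Longrightarrow> J \<subset> J' \<Longrightarrow> J' = UNIV"
    using J by (auto simp: maximal_nat_ideal_def)
  then have proper: "UNIV \<notin> J"
    using proper_ideal_iff by blast
  have decide: "A \<in> J \<or> - A \<in> J" for A
  proof (rule disjCI)
    assume notin: "- A \<notin> J"
    define J' where "J' = {B. A \<inter> B \<in> J}"
    have "J \<subseteq> J'"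
      using ideal_subset[OF ideal] unfolding J'_def by blast
    moreover have "- A \<in> J'"
      using ideal_empty[OF ideal] by (simp add: J'_def)
    ultimately have "J \<subset> J'"
      using notin by blast
    then have "J' = UNIV"
      using max[of J'] nat_ideal_trace[OF ideal, of A] unfolding J'_def by blast
    then have "UNIV \<in> J'"
      by simp
    then show "A \<in> J"
      by (simp add: J'_def)
  qed
  have exclusive: "\<not> (A \<in> J \<and> - A \<in> J)" for A
    using ideal_Un[OF ideal, of A "- A"] proper by auto
  show "dual_filter J = - J"
    using decide exclusive by (simp add: dual_filter_iff set_eq_iff) blast
  show "nat_ultrafilter (- J)"
    unfolding nat_ultrafilter_def
  proof (intro conjI allI impI)
    show "UNIV \<in> - J" "{} \<notin> - J"
      using proper ideal_empty[OF ideal] by auto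
    show "B \<in> - J" if "A \<in> - J" "A \<subseteq> B" for A B
      using that ideal_subset[OF ideal] by auto
    show "A \<inter> B \<in> - J" if "A \<in> - J" "B \<in> - J" for A B
    proof -
      have "- A \<union> - B \<in> J"
        using that decide ideal_Un[OF ideal] by blast
      then show ?thesis
        using exclusive[of "A \<inter> B"] by auto
    qed
    show "A \<in> - J \<or> UNIV - A \<in> - J" for A
      using exclusive by (auto simp: Compl_eq_Diff_UNIV)
  qed
qed

lemma ultrafilter_imp_maximal_ideal:
  assumes p: "nat_ultrafilter p" and free: "\<And>A. finite A \<Longrightarrow> A \<notin> p"
  shows "maximal_nat_ideal (- p)"
proof -
  have "nat_ideal (- p)"
    unfolding nat_ideal_def using free ultrafilter_superset[OF p] ultrafilter_Un_iff[OF p] by auto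
  moreover have "J' = UNIV" if J': "nat_ideal J'" and larger: "- p \<subset> J'" for J'
  proof -
    obtain B where "B \<in> J'" "B \<in> p"
      using larger by blast
    moreover have "- B \<in> J'"
      using larger \<open>B \<in> p\<close> ultrafilter_Compl_iff[OF p] by blast
    ultimately have "UNIV \<in> J'"
      using ideal_Un[OF J', of B "- B"] by simp
    then show ?thesis
      using proper_ideal_iff[OF J'] by blast
  qed
  ultimately show ?thesis
    using ultrafilter_UNIV[OF p] by (auto simp: maximal_nat_ideal_def)
qed

lemma ex_maximal_ideal:
  assumes I: "nat_ideal I" and proper: "UNIV \<notin> I"
  obtains J where "maximal_nat_ideal J" and "I \<subseteq> J"
proof -
  let ?P = "{J. nat_ideal J \<and> I \<subseteq> J \<and> UNIV \<notin> J}"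
  have "\<exists>M\<in>?P. \<forall>X\<in>?P. M \<subseteq> X \<longrightarrow> X = M"
  proof (rule subset_Zorn_nonempty)
    show "?P \<noteq> {}"
      using assms by blast
    fix C assume "C \<noteq> {}" and chain: "subset.chain ?P C"
    have sub: "C \<subseteq> ?P" and total: "\<And>X Y. X \<in> C \<Longrightarrow> Y \<in> C \<Longrightarrow> X \<subseteq> Y \<or> Y \<subseteq> X"
      using chain unfolding subset_chain_def by auto
    obtain X0 where X0: "X0 \<in> C"
      using \<open>C \<noteq> {}\<close> by blast
    have Un: "A \<union> B \<in> \<Union>C" if AB: "A \<in> \<Union>C" "B \<in> \<Union>C" for A B
    proof -
      obtain X Y where XY: "X \<in> C" "A \<in> X" "Y \<in> C" "B \<in> Y"
        using AB by blast
      then obtain Z where "Z \<in> C" "A \<in> Z" "B \<in> Z"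
        using total[of X Y] by blast
      moreover have "nat_ideal Z"
        using \<open>Z \<in> C\<close> sub by blast
      ultimately show ?thesis
        using ideal_Un by blast
    qed
    have "nat_ideal (\<Union>C)"
      unfolding nat_ideal_def
    proof (intro conjI allI impI)
      show "{} \<in> \<Union>C" "finite A \<Longrightarrow> A \<in> \<Union>C" for A
        using X0 sub ideal_finite[of X0] by blast+
      show "B \<in> \<Union>C" if "A \<in> \<Union>C" "B \<subseteq> A" for A B
        using that sub ideal_subset by blast
    qed (rule Un)
    then show "\<Union>C \<in> ?P"
      using X0 sub by blast
  qed
  then obtain M where M: "M \<in> ?P" and max: "\<forall>X\<in>?P. M \<subseteq> X \<longrightarrow> X = M"
    by (rule bexE)
  have "J' = UNIV" if "nat_ideal J'" and "M \<subset> J'" for J'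
  proof (rule ccontr)
    assume "J' \<noteq> UNIV"
    then have "J' \<in> ?P"
      using that M proper_ideal_iff by auto
    then show False
      using max that(2) by blast
  qed
  then have "maximal_nat_ideal M"
    using M by (auto simp: maximal_nat_ideal_def)
  with M show thesis
    using that by blast
qed

text \<open>The sets that meet \<open>A\<close> in a member of \<open>I\<close> form a proper ideal, and the complement of
  \<open>A\<close> is one of them.\<close>

lemma ex_ultrafilter_of_positive_set:
  assumes I: "nat_ideal I" and "A \<notin> I"
  obtains p where "nat_ultrafilter p" and "I \<subseteq> - p" and "A \<in> p"
proof -
  let ?J = "{B. A \<inter> B \<in> I}"
  have "nat_ideal ?J"
    by (rule nat_ideal_trace[OF I])
  moreover have "UNIV \<notin> ?J"
    using assms by simp
  ultimately obtain J where J: "maximal_nat_ideal J" "?J \<subseteq> J"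
    using ex_maximal_ideal by blast
  have ultra: "nat_ultrafilter (- J)"
    by (rule maximal_ideal_dual[OF J(1)])
  have "I \<subseteq> J"
    using J(2) ideal_subset[OF I] by blast
  moreover have "- A \<in> J"
    using J(2) ideal_empty[OF I] by auto
  ultimately show thesis
    using that[of "- J"] ultra ultrafilter_Compl_iff[OF ultra, of A] by auto
qed

lemma topspace_K_space: "topspace (K_space I) = {p. nat_ultrafilter p \<and> I \<subseteq> - p}"
proof (rule set_eqI)
  fix p
  have "p \<in> topspace (K_space I) \<longleftrightarrow> nat_ultrafilter p \<and> dual_filter I \<subseteq> p"
    unfolding K_space_def topspace_subtopology topspace_beta_nat by blast
  also have "\<dots> \<longleftrightarrow> nat_ultrafilter p \<and> I \<subseteq> - p"
    using dual_filter_subset_iff by blast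
  finally show "p \<in> topspace (K_space I) \<longleftrightarrow> p \<in> {p. nat_ultrafilter p \<and> I \<subseteq> - p}"
    by simp
qed

lemma ideal_eq_K_space_null_sets:
  assumes "nat_ideal I"
  shows "A \<in> I \<longleftrightarrow> (\<forall>p \<in> topspace (K_space I). A \<notin> p)"
proof
  show "A \<in> I" if "\<forall>p \<in> topspace (K_space I). A \<notin> p"
  proof (rule ccontr)
    assume "A \<notin> I"
    then obtain p where "nat_ultrafilter p" "I \<subseteq> - p" "A \<in> p"
      by (rule ex_ultrafilter_of_positive_set[OF assms])
    then show False
      using that unfolding topspace_K_space by blast
  qed
qed (auto simp: topspace_K_space)

section \<open>The topology of the space of ultrafilters\<close>

lemma openin_beta_nat_iff:
  "openin beta_nat U \<longleftrightarrow>
     (\<forall>p\<in>U. nat_ultrafilter p \<and> (\<exists>A\<in>p. \<forall>q. nat_ultrafilter q \<longrightarrow> A \<in> q \<longrightarrow> q \<in> U))"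
proof
  assume U: "openin beta_nat U"
  then have "generate_topology_on (range (\<lambda>A. {p. nat_ultrafilter p \<and> A \<in> p})) U"
    unfolding beta_nat_def by (rule openin_topology_generated_by)
  then show "\<forall>p\<in>U. nat_ultrafilter p \<and> (\<exists>A\<in>p. \<forall>q. nat_ultrafilter q \<longrightarrow> A \<in> q \<longrightarrow> q \<in> U)"
  proof (induction)
    case (Int a b)
    show ?case
    proof
      fix p assume p: "p \<in> a \<inter> b"
      obtain A where A: "A \<in> p" "\<forall>q. nat_ultrafilter q \<longrightarrow> A \<in> q \<longrightarrow> q \<in> a"
        using p Int.IH(1) by blast
      obtain B where B: "B \<in> p" "\<forall>q. nat_ultrafilter q \<longrightarrow> B \<in> q \<longrightarrow> q \<in> b"
        using p Int.IH(2) by blast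
      have ultra: "nat_ultrafilter p"
        using p Int.IH(1) by blast
      have "A \<inter> B \<in> p"
        using A(1) B(1) ultra ultrafilter_Int_iff by blast
      moreover have "\<forall>q. nat_ultrafilter q \<longrightarrow> A \<inter> B \<in> q \<longrightarrow> q \<in> a \<inter> b"
        using A(2) B(2) ultrafilter_Int_iff by blast
      ultimately show "nat_ultrafilter p \<and>
          (\<exists>A\<in>p. \<forall>q. nat_ultrafilter q \<longrightarrow> A \<in> q \<longrightarrow> q \<in> a \<inter> b)"
        using ultra by blast
    qed
  next
    case (UN K)
    show ?case
    proof
      fix p assume "p \<in> \<Union>K"
      then obtain k where k: "k \<in> K" "p \<in> k"
        by blast
      have ultra: "nat_ultrafilter p"
        using bspec[OF UN.IH[OF k(1)] k(2)] by (rule conjunct1)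
      obtain A where "A \<in> p" and A: "\<forall>q. nat_ultrafilter q \<longrightarrow> A \<in> q \<longrightarrow> q \<in> k"
        using bspec[OF UN.IH[OF k(1)] k(2)] by (elim conjE bexE)
      then show "nat_ultrafilter p \<and>
          (\<exists>A\<in>p. \<forall>q. nat_ultrafilter q \<longrightarrow> A \<in> q \<longrightarrow> q \<in> \<Union>K)"
        using ultra k(1) by (intro conjI bexI[of _ A] allI impI UnionI[of k]) simp_all
    qed
  next
    case (Basis s)
    then obtain A where "s = {p. nat_ultrafilter p \<and> A \<in> p}"
      by blast
    then show ?case
      by blast
  qed simp
next
  assume U: "\<forall>p\<in>U. nat_ultrafilter p \<and> (\<exists>A\<in>p. \<forall>q. nat_ultrafilter q \<longrightarrow> A \<in> q \<longrightarrow> q \<in> U)"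
  show "openin beta_nat U"
  proof (subst openin_subopen, intro ballI)
    fix p assume "p \<in> U"
    with U obtain A where "nat_ultrafilter p" "A \<in> p"
      "\<forall>q. nat_ultrafilter q \<longrightarrow> A \<in> q \<longrightarrow> q \<in> U"
      by blast
    moreover have "openin beta_nat {q. nat_ultrafilter q \<and> A \<in> q}"
      unfolding beta_nat_def by (rule topology_generated_by_Basis) simp
    ultimately show "\<exists>T. openin beta_nat T \<and> p \<in> T \<and> T \<subseteq> U"
      by (intro exI[of _ "{q. nat_ultrafilter q \<and> A \<in> q}"]) auto
  qed
qed

lemma openin_beta_nat_imp_basic:
  assumes "openin beta_nat U" and "q \<in> U"
  obtains A where "A \<in> q" and "{r. nat_ultrafilter r \<and> A \<in> r} \<subseteq> U"
proof -
  have "\<exists>A\<in>q. \<forall>r. nat_ultrafilter r \<longrightarrow> A \<in> r \<longrightarrow> r \<in> U"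
    using assms by (simp add: openin_beta_nat_iff)
  then obtain A where "A \<in> q" and A: "\<forall>r. nat_ultrafilter r \<longrightarrow> A \<in> r \<longrightarrow> r \<in> U"
    by (elim bexE)
  moreover have "{r. nat_ultrafilter r \<and> A \<in> r} \<subseteq> U"
    using A by (intro subsetI) (simp add: conj_imp_eq_imp_imp)
  ultimately show thesis
    using that by blast
qed

lemma openin_beta_nat_basic: "openin beta_nat {p. nat_ultrafilter p \<and> A \<in> p}"
  unfolding openin_beta_nat_iff by blast

lemma discrete_in_beta_nat_iff:
  assumes P: "\<And>p. p \<in> P \<Longrightarrow> nat_ultrafilter p"
  shows "subtopology beta_nat P = discrete_topology P \<longleftrightarrow>
    (\<forall>p\<in>P. \<exists>A. \<forall>q\<in>P. A \<in> q \<longleftrightarrow> q = p)"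
proof
  assume discrete: "subtopology beta_nat P = discrete_topology P"
  show "\<forall>p\<in>P. \<exists>A. \<forall>q\<in>P. A \<in> q \<longleftrightarrow> q = p"
  proof
    fix p assume "p \<in> P"
    then have "openin (subtopology beta_nat P) {p}"
      by (simp add: discrete)
    then obtain U where "openin beta_nat U" and U: "{p} = U \<inter> P"
      by (auto simp: openin_subtopology)
    have "p \<in> U"
      using U by blast
    with \<open>openin beta_nat U\<close> obtain A where "A \<in> p" "{q. nat_ultrafilter q \<and> A \<in> q} \<subseteq> U"
      by (rule openin_beta_nat_imp_basic)
    then have "\<forall>q\<in>P. A \<in> q \<longleftrightarrow> q = p"
      using U P by blast
    then show "\<exists>A. \<forall>q\<in>P. A \<in> q \<longleftrightarrow> q = p" ..
  qed
next
  assume isolated: "\<forall>p\<in>P. \<exists>A. \<forall>q\<in>P. A \<in> q \<longleftrightarrow> q = p"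
  have "openin (subtopology beta_nat P) {p}" if p: "p \<in> P" for p
  proof -
    obtain A where "\<forall>q\<in>P. A \<in> q \<longleftrightarrow> q = p"
      using isolated p by blast
    then have "{p} = {q. nat_ultrafilter q \<and> A \<in> q} \<inter> P"
      using p P by auto
    then show ?thesis
      unfolding openin_subtopology using openin_beta_nat_basic[of A] by blast
  qed
  moreover have "topspace (subtopology beta_nat P) = P"
    using P by (auto simp: topspace_beta_nat)
  ultimately show "subtopology beta_nat P = discrete_topology P"
    by (metis discrete_topology_unique)
qed

section \<open>Discrete families of ultrafilters\<close>

text \<open>Strong \<open>\<omega>\<close>-maximality in the form in which the other conditions deliver it.
  Repetitions in the family are allowed, because a discrete projection yields one ultrafilter for
  every natural number and these coincide along the atoms of its algebra of fixed sets.\<close>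

definition discrete_ultrafilter_family :: "nat set set \<Rightarrow> (nat \<Rightarrow> nat set set) \<Rightarrow> bool" where
  "discrete_ultrafilter_family I p \<longleftrightarrow>
     infinite (range p) \<and> (\<forall>n. nat_ultrafilter (p n)) \<and>
     (\<forall>n. \<exists>A. \<forall>m. A \<in> p m \<longleftrightarrow> p m = p n) \<and>
     (\<forall>B. B \<in> I \<longleftrightarrow> (\<forall>n. B \<notin> p n))"

lemma discrete_ultrafilter_familyI:
  assumes "\<And>n. nat_ultrafilter (p n)"
    and "\<And>n. \<exists>A. \<forall>m. A \<in> p m \<longleftrightarrow> m = n"
    and "\<And>B. B \<in> I \<longleftrightarrow> (\<forall>n. B \<notin> p n)"
  shows "discrete_ultrafilter_family I p"
proof -
  have "inj p"
    by (rule injI) (metis assms(2))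
  then show ?thesis
    using assms by (simp add: discrete_ultrafilter_family_def finite_image_iff inj_eq)
qed

lemma strongly_omega_maximal_iff:
  assumes I: "nat_ideal I"
  shows "strongly_omega_maximal I \<longleftrightarrow> (\<exists>p. discrete_ultrafilter_family I p)"
proof
  assume "strongly_omega_maximal I"
  then obtain M where "countable M" "infinite M" and max: "\<And>J. J \<in> M \<Longrightarrow> maximal_nat_ideal J"
    and IM: "I = \<Inter>M"
    and discrete: "subtopology beta_nat (dual_filter ` M) = discrete_topology (dual_filter ` M)"
    unfolding strongly_omega_maximal_def by blast
  let ?p = "\<lambda>n. - from_nat_into M n"
  have dual: "dual_filter ` M = uminus ` M"
    using maximal_ideal_dual(1)[OF max] by (simp cong: image_cong)
  have range: "range ?p = uminus ` M"
    unfolding image_image[symmetric, of uminus "from_nat_into M"]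
    using bij_betw_from_nat_into[OF \<open>countable M\<close> \<open>infinite M\<close>] by (simp add: bij_betw_def)
  have ultra: "nat_ultrafilter q" if "q \<in> uminus ` M" for q
    using that maximal_ideal_dual(2)[OF max] by blast
  have isolated: "\<forall>q\<in>range ?p. \<exists>A. \<forall>r\<in>range ?p. A \<in> r \<longleftrightarrow> r = q"
    using discrete discrete_in_beta_nat_iff[of "range ?p"] ultra
    unfolding dual range by blast
  have "inj_on uminus M"
    by (simp add: inj_on_def)
  have "discrete_ultrafilter_family I ?p"
    unfolding discrete_ultrafilter_family_def
  proof (intro conjI allI)
    show "infinite (range ?p)"
      using \<open>infinite M\<close> \<open>inj_on uminus M\<close> unfolding range by (simp add: finite_image_iff)
    show "nat_ultrafilter (?p n)" for n
      using ultra range by blast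
    show "\<exists>A. \<forall>m. A \<in> ?p m \<longleftrightarrow> ?p m = ?p n" for n
      using isolated by (simp only: ball_simps)
    fix B
    have "B \<in> I \<longleftrightarrow> (\<forall>q \<in> range ?p. B \<notin> q)"
      unfolding range by (simp add: IM)
    then show "B \<in> I \<longleftrightarrow> (\<forall>n. B \<notin> ?p n)"
      by (simp only: ball_simps)
  qed
  then show "\<exists>p. discrete_ultrafilter_family I p"
    by (rule exI[of _ ?p])
next
  assume "\<exists>p. discrete_ultrafilter_family I p"
  then obtain p :: "nat \<Rightarrow> nat set set" where inf: "infinite (range p)" and ultra: "\<And>n. nat_ultrafilter (p n)"
    and isolated: "\<And>n. \<exists>A. \<forall>m. A \<in> p m \<longleftrightarrow> p m = p n"
    and null: "\<And>B. B \<in> I \<longleftrightarrow> (\<forall>n. B \<notin> p n)"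
    unfolding discrete_ultrafilter_family_def by blast
  have max: "maximal_nat_ideal (- p n)" for n
    using ideal_finite[OF I] null by (intro ultrafilter_imp_maximal_ideal[OF ultra]) blast
  have "dual_filter (- p n) = p n" for n
    using maximal_ideal_dual(1)[OF max] by simp
  then have dual: "dual_filter ` range (\<lambda>n. - p n) = range p"
    by (simp add: image_image)
  show "strongly_omega_maximal I"
    unfolding strongly_omega_maximal_def
  proof (intro exI[of _ "range (\<lambda>n. - p n)"] conjI)
    have "infinite (uminus ` range p)"
      using inf by (simp add: finite_image_iff inj_on_def)
    then show "infinite (range (\<lambda>n. - p n))"
      by (simp add: image_image)
    show "I = \<Inter> (range (\<lambda>n. - p n))"
      using null by auto
    show "subtopology beta_nat (dual_filter ` range (\<lambda>n. - p n)) =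
        discrete_topology (dual_filter ` range (\<lambda>n. - p n))"
      unfolding dual using ultra isolated by (subst discrete_in_beta_nat_iff) auto
  qed (use max in auto)
qed

text \<open>The form in which strong \<open>\<omega>\<close>-maximality is used: one map \<open>c\<close> whose fibres
  separate the ultrafilters. Since the fibres partition the natural numbers, unions of them are
  preimages under \<open>c\<close>, and a sequence that is constant on each fibre is a composition
  with \<open>c\<close>.\<close>

locale separated_ultrafilters =
  fixes I :: "nat set set" and p :: "nat \<Rightarrow> nat set set" and c :: "nat \<Rightarrow> nat"
  assumes ultra: "nat_ultrafilter (p n)"
    and fibre: "c -` {n} \<in> p n"
    and null: "B \<in> I \<longleftrightarrow> (\<forall>n. B \<notin> p n)"

text \<open>If \<open>A n\<close> isolates the \<open>n\<close>-th ultrafilter then so does \<open>A n\<close> minus the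
  earlier sets, since the ultrafilter contains none of these; sending a point of \<open>A n\<close> to the
  first index that captures it realises this disjointification by a map.\<close>

lemma discrete_family_imp_separated:
  assumes "discrete_ultrafilter_family I q"
  obtains p c where "separated_ultrafilters I p c"
proof -
  have inf: "infinite (range q)" and ultra: "\<And>n. nat_ultrafilter (q n)"
    and isolated: "\<And>n. \<exists>A. \<forall>m. A \<in> q m \<longleftrightarrow> q m = q n"
    and null: "\<And>B. B \<in> I \<longleftrightarrow> (\<forall>n. B \<notin> q n)"
    using assms unfolding discrete_ultrafilter_family_def by blast+
  define p where "p = from_nat_into (range q)"
  have bij: "bij_betw p UNIV (range q)"
    unfolding p_def using inf by (intro bij_betw_from_nat_into) auto
  then have inj: "inj p" and range: "range p = range q"
    by (auto simp: bij_betw_def)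
  have ultra_p: "nat_ultrafilter (p n)" for n
    using range ultra by (metis rangeE rangeI)
  have "\<exists>A. \<forall>m. A \<in> p m \<longleftrightarrow> m = n" for n
  proof -
    obtain k where "p n = q k"
      using range by (metis rangeE rangeI)
    with isolated[of k] obtain A where "\<And>m. A \<in> q m \<longleftrightarrow> q m = p n"
      by metis
    then have "A \<in> p m \<longleftrightarrow> p m = p n" for m
      using range by (metis rangeE rangeI)
    then show ?thesis
      using inj by (auto simp: inj_eq)
  qed
  then obtain A where A: "\<And>m n. A n \<in> p m \<longleftrightarrow> m = n"
    by metis
  \<comment> \<open>Points outside all \<open>A n\<close> go to an unspecified index, which can only enlarge a fibre.\<close>
  define c where "c k = (LEAST n. k \<in> A n)" for k
  have "c -` {n} \<in> p n" for n
  proof (rule ultrafilter_superset[OF ultra_p])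
    have "- (\<Union>m\<in>{..<n}. A m) \<in> p n"
      unfolding ultrafilter_Compl_iff[OF ultra_p]
      by (rule ultrafilter_UN_finite[OF ultra_p]) (auto simp: A)
    then show "A n \<inter> - (\<Union>m\<in>{..<n}. A m) \<in> p n"
      by (simp add: A ultrafilter_Int_intro[OF ultra_p])
    show "A n \<inter> - (\<Union>m\<in>{..<n}. A m) \<subseteq> c -` {n}"
      by (auto simp: c_def intro!: Least_equality) (metis lessThan_iff not_le)
  qed
  moreover have "B \<in> I \<longleftrightarrow> (\<forall>n. B \<notin> p n)" for B
  proof -
    have "(\<forall>n. B \<notin> q n) \<longleftrightarrow> (\<forall>r\<in>range q. B \<notin> r)"
      by simp
    also have "\<dots> \<longleftrightarrow> (\<forall>n. B \<notin> p n)"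
      unfolding range[symmetric] by simp
    finally show ?thesis
      using null by simp
  qed
  ultimately show thesis
    using that ultra_p by (metis separated_ultrafilters.intro)
qed

lemma (in separated_ultrafilters) vimage_in_ultrafilter_iff: "c -` E \<in> p n \<longleftrightarrow> n \<in> E"
proof
  assume "n \<in> E"
  then show "c -` E \<in> p n"
    using ultrafilter_superset[OF ultra fibre] by (metis empty_subsetI insert_subset vimage_mono)
next
  assume "c -` E \<in> p n"
  then have "c -` E \<inter> c -` {n} \<in> p n"
    using fibre ultrafilter_Int_intro[OF ultra] by blast
  then have "c -` E \<inter> c -` {n} \<noteq> {}"
    using ultrafilter_empty[OF ultra] by metis
  then show "n \<in> E"
    by auto
qed

section \<open>Limits along ultrafilters\<close>

lemma linf_abs_le_norm: "\<bar>apply_bcontfun x n\<bar> \<le> norm x" for x :: linf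
  using norm_bounded[of x n] by simp

lemma linf_norm_le: "(\<And>n. \<bar>apply_bcontfun x n\<bar> \<le> b) \<Longrightarrow> norm x \<le> b" for x :: linf
  by (rule norm_bound) simp

lemma Bcontfun_apply:
  fixes f :: "nat \<Rightarrow> real"
  assumes "\<And>n. \<bar>f n\<bar> \<le> b"
  shows "apply_bcontfun (Bcontfun f) n = f n"
  using assms by (subst Bcontfun_inverse) (auto intro!: bounded_seq_in_bcontfun boundedI)

definition ultra_filter :: "nat set set \<Rightarrow> nat filter" where
  "ultra_filter p = Abs_filter (\<lambda>P. Collect P \<in> p)"

lemma eventually_ultra_filter:
  assumes "nat_ultrafilter p"
  shows "eventually P (ultra_filter p) \<longleftrightarrow> Collect P \<in> p"
  unfolding ultra_filter_def
proof (rule eventually_Abs_filter, rule is_filter.intro)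
  show "Collect (\<lambda>x. True) \<in> p"
    using ultrafilter_UNIV[OF assms] by simp
  show "Collect (\<lambda>x. P x \<and> Q x) \<in> p" if "Collect P \<in> p" "Collect Q \<in> p" for P Q
    using ultrafilter_Int_intro[OF assms that] by (simp only: Collect_conj_eq)
  show "Collect Q \<in> p" if "\<forall>x. P x \<longrightarrow> Q x" "Collect P \<in> p" for P Q
    using ultrafilter_superset[OF assms that(2)] that(1) by blast
qed

lemma ultra_filter_nontrivial: "nat_ultrafilter p \<Longrightarrow> ultra_filter p \<noteq> bot"
  by (simp add: trivial_limit_def eventually_ultra_filter ultrafilter_empty)

definition ultra_limit :: "nat set set \<Rightarrow> linf \<Rightarrow> real" where
  "ultra_limit p x = Lim (ultra_filter p) (apply_bcontfun x)"

lemma ultra_limit_eqI: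
  "nat_ultrafilter p \<Longrightarrow> (apply_bcontfun x \<longlongrightarrow> l) (ultra_filter p) \<Longrightarrow> ultra_limit p x = l"
  unfolding ultra_limit_def by (rule tendsto_Lim) (simp_all add: ultra_filter_nontrivial)

text \<open>The limit is the supremum of all \<open>r\<close> that the sequence exceeds on a set of the
  ultrafilter: for a number above it, the sequence stays below on a set of the ultrafilter,
  because one of two complementary sets always belongs to it.\<close>

lemma tendsto_ultra_limit:
  assumes p: "nat_ultrafilter p"
  shows "(apply_bcontfun x \<longlongrightarrow> ultra_limit p x) (ultra_filter p)"
proof -
  define R where "R = {r. {n. r \<le> apply_bcontfun x n} \<in> p}"
  have bounds: "- norm x \<le> apply_bcontfun x n" "apply_bcontfun x n \<le> norm x" for n
    using linf_abs_le_norm[of x n] by (simp_all add: abs_le_iff)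
  have "{n. - norm x \<le> apply_bcontfun x n} = UNIV"
    using bounds by blast
  then have "- norm x \<in> R"
    using ultrafilter_UNIV[OF p] by (simp add: R_def)
  then have "R \<noteq> {}"
    by blast
  have "bdd_above R"
  proof (rule bdd_aboveI)
    fix r assume "r \<in> R"
    then have "{n. r \<le> apply_bcontfun x n} \<noteq> {}"
      using ultrafilter_empty[OF p] unfolding R_def by (metis mem_Collect_eq)
    then show "r \<le> norm x"
      using bounds(2) order_trans by blast
  qed
  have "(apply_bcontfun x \<longlongrightarrow> Sup R) (ultra_filter p)"
  proof (rule order_tendstoI)
    fix a assume "a < Sup R"
    then obtain r where "r \<in> R" "a < r"
      using less_cSup_iff[OF \<open>R \<noteq> {}\<close> \<open>bdd_above R\<close>] by blast
    moreover have "{n. r \<le> apply_bcontfun x n} \<subseteq> {n. a < apply_bcontfun x n}"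
      using \<open>a < r\<close> by auto
    ultimately show "eventually (\<lambda>n. a < apply_bcontfun x n) (ultra_filter p)"
      unfolding eventually_ultra_filter[OF p] R_def using ultrafilter_superset[OF p] by blast
  next
    fix a assume "Sup R < a"
    then have "a \<notin> R"
      using cSup_upper[OF _ \<open>bdd_above R\<close>] by force
    then have "- {n. a \<le> apply_bcontfun x n} \<in> p"
      unfolding R_def by (simp add: ultrafilter_Compl_iff[OF p])
    also have "- {n. a \<le> apply_bcontfun x n} = {n. apply_bcontfun x n < a}"
      by auto
    finally show "eventually (\<lambda>n. apply_bcontfun x n < a) (ultra_filter p)"
      by (simp add: eventually_ultra_filter[OF p])
  qed
  then show ?thesis
    using ultra_limit_eqI[OF p] by simp
qed

lemma abs_ultra_limit_le:
  assumes p: "nat_ultrafilter p"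
  shows "\<bar>ultra_limit p x\<bar> \<le> norm x"
proof (rule tendsto_upperbound)
  show "((\<lambda>n. \<bar>apply_bcontfun x n\<bar>) \<longlongrightarrow> \<bar>ultra_limit p x\<bar>) (ultra_filter p)"
    by (intro tendsto_rabs tendsto_ultra_limit[OF p])
qed (simp_all add: linf_abs_le_norm ultra_filter_nontrivial[OF p])

lemma ultra_limit_add:
  assumes p: "nat_ultrafilter p"
  shows "ultra_limit p (x + y) = ultra_limit p x + ultra_limit p y"
  using tendsto_add[OF tendsto_ultra_limit[OF p, of x] tendsto_ultra_limit[OF p, of y]]
  by (intro ultra_limit_eqI[OF p]) simp

lemma ultra_limit_scaleR:
  assumes p: "nat_ultrafilter p"
  shows "ultra_limit p (r *\<^sub>R x) = r * ultra_limit p x"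
  using tendsto_mult[OF tendsto_const tendsto_ultra_limit[OF p, of x]]
  by (intro ultra_limit_eqI[OF p]) simp

lemma ultra_limit_sup:
  assumes p: "nat_ultrafilter p"
  shows "ultra_limit p (linf_sup x y) = max (ultra_limit p x) (ultra_limit p y)"
  using tendsto_max[OF tendsto_ultra_limit[OF p, of x] tendsto_ultra_limit[OF p, of y]]
  by (intro ultra_limit_eqI[OF p]) (simp only: linf_sup_apply[symmetric])

lemma ultra_limit_inf:
  assumes p: "nat_ultrafilter p"
  shows "ultra_limit p (linf_inf x y) = min (ultra_limit p x) (ultra_limit p y)"
  using tendsto_min[OF tendsto_ultra_limit[OF p, of x] tendsto_ultra_limit[OF p, of y]]
  by (intro ultra_limit_eqI[OF p]) (simp only: linf_inf_apply[symmetric])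

lemma ultra_limit_eventually_const:
  assumes p: "nat_ultrafilter p" and "A \<in> p" and "\<And>n. n \<in> A \<Longrightarrow> apply_bcontfun x n = l"
  shows "ultra_limit p x = l"
proof (rule ultra_limit_eqI[OF p], rule tendsto_eventually)
  have "{n. apply_bcontfun x n = l} \<in> p"
    by (rule ultrafilter_superset[OF p \<open>A \<in> p\<close>]) (use assms(3) in blast)
  then show "eventually (\<lambda>n. apply_bcontfun x n = l) (ultra_filter p)"
    by (simp add: eventually_ultra_filter[OF p])
qed

lemma ultra_limit_eq_0_iff:
  assumes p: "nat_ultrafilter p"
  shows "ultra_limit p x = 0 \<longleftrightarrow> (\<forall>e>0. {n. e \<le> \<bar>apply_bcontfun x n\<bar>} \<notin> p)"
proof -
  have "ultra_limit p x = 0 \<longleftrightarrow> (apply_bcontfun x \<longlongrightarrow> 0) (ultra_filter p)"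
    using ultra_limit_eqI[OF p] tendsto_ultra_limit[OF p] by metis
  also have "\<dots> \<longleftrightarrow> (\<forall>e>0. {n. \<bar>apply_bcontfun x n\<bar> < e} \<in> p)"
    by (simp add: tendsto_iff eventually_ultra_filter[OF p])
  also have "\<dots> \<longleftrightarrow> (\<forall>e>0. - {n. e \<le> \<bar>apply_bcontfun x n\<bar>} \<in> p)"
    by (simp add: Collect_neg_eq[symmetric] not_le)
  finally show ?thesis
    by (simp add: ultrafilter_Compl_iff[OF p])
qed

section \<open>Coordinates on the quotient\<close>

context separated_ultrafilters
begin

text \<open>The limits along the ultrafilters identify the quotient with the bounded sequences.
  Composition with \<open>c\<close> lifts a bounded sequence to a representative, without increasing the norm,
  because the lift is constant on the set \<open>c -` {n}\<close> of the \<open>n\<close>-th ultrafilter.\<close>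

definition coords :: "linf \<Rightarrow> linf" where
  "coords x = Bcontfun (\<lambda>n. ultra_limit (p n) x)"

definition spread :: "linf \<Rightarrow> linf" where
  "spread y = Bcontfun (\<lambda>k. apply_bcontfun y (c k))"

lemma coords_apply: "apply_bcontfun (coords x) n = ultra_limit (p n) x"
  unfolding coords_def by (rule Bcontfun_apply) (rule abs_ultra_limit_le[OF ultra])

lemma spread_apply: "apply_bcontfun (spread y) k = apply_bcontfun y (c k)"
  unfolding spread_def by (rule Bcontfun_apply) (rule linf_abs_le_norm)

lemma norm_coords_le: "norm (coords x) \<le> norm x"
  by (rule linf_norm_le) (simp add: coords_apply abs_ultra_limit_le[OF ultra])

lemma norm_spread_le: "norm (spread y) \<le> norm y"
  by (rule linf_norm_le) (simp add: spread_apply linf_abs_le_norm)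

lemma coords_add: "coords (x + y) = coords x + coords y"
  by (rule bcontfun_eqI) (simp add: coords_apply ultra_limit_add[OF ultra])

lemma coords_scaleR: "coords (r *\<^sub>R x) = r *\<^sub>R coords x"
  by (rule bcontfun_eqI) (simp add: coords_apply ultra_limit_scaleR[OF ultra])

lemma linear_coords: "linear coords"
  by (rule linearI) (rule coords_add coords_scaleR)+

lemma coords_sup: "coords (linf_sup x y) = linf_sup (coords x) (coords y)"
  by (rule bcontfun_eqI) (simp add: coords_apply linf_sup_apply ultra_limit_sup[OF ultra])

lemma coords_inf: "coords (linf_inf x y) = linf_inf (coords x) (coords y)"
  by (rule bcontfun_eqI) (simp add: coords_apply linf_inf_apply ultra_limit_inf[OF ultra])

lemma coords_spread: "coords (spread y) = y"
proof (rule bcontfun_eqI)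
  show "apply_bcontfun (coords (spread y)) n = apply_bcontfun y n" for n
    unfolding coords_apply
    by (rule ultra_limit_eventually_const[OF ultra fibre]) (simp add: spread_apply)
qed

lemma coords_eq_0_iff: "coords x = 0 \<longleftrightarrow> x \<in> c0 I"
proof -
  have "coords x = 0 \<longleftrightarrow> (\<forall>n. ultra_limit (p n) x = 0)"
    by (metis bcontfun_eqI coords_apply zero_bcontfun.rep_eq)
  then show ?thesis
    by (simp add: ultra_limit_eq_0_iff[OF ultra] c0_def null) blast
qed

lemma coords_chi: "coords (chi A) = chi {n. A \<in> p n}"
proof (rule bcontfun_eqI)
  fix n
  show "apply_bcontfun (coords (chi A)) n = apply_bcontfun (chi {n. A \<in> p n}) n"
  proof (cases "A \<in> p n")
    case True
    from ultra_limit_eventually_const[OF ultra this, of "chi A" 1] True show ?thesis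
      by (simp add: coords_apply chi_apply)
  next
    case False
    then have "- A \<in> p n"
      by (simp add: ultrafilter_Compl_iff[OF ultra])
    from ultra_limit_eventually_const[OF ultra this, of "chi A" 0] False show ?thesis
      by (simp add: coords_apply chi_apply)
  qed
qed

lemma spread_chi: "spread (chi E) = chi (c -` E)"
  by (rule bcontfun_eqI) (simp add: spread_apply chi_apply indicator_def)

end

section \<open>Operators on the quotient and operators with the same kernel\<close>

definition quotient_operator :: "nat set set \<Rightarrow> (linf \<Rightarrow> linf) \<Rightarrow> bool" where
  "quotient_operator I S \<longleftrightarrow> linear S \<and> surj S \<and> (\<forall>x. S x = 0 \<longleftrightarrow> x \<in> c0 I)"

lemma quot_class: "c0_rel I `` {x} \<in> quot I"
  by (simp add: quot_def quotientI)

lemma quotE: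
  assumes "X \<in> quot I"
  obtains x where "X = c0_rel I `` {x}"
  using assms unfolding quot_def by (rule quotientE)

lemma quotient_operator_factors:
  assumes I: "nat_ideal I" and S: "quotient_operator I S"
  obtains T where "bij_betw T (quot I) UNIV" and "quot_linear I T"
    and "\<And>x. T (c0_rel I `` {x}) = S x"
proof -
  have linear: "linear S" and "surj S" and kernel: "\<And>x. S x = 0 \<longleftrightarrow> x \<in> c0 I"
    using S by (auto simp: quotient_operator_def)
  have S_eq: "S x = S y \<longleftrightarrow> (x, y) \<in> c0_rel I" for x y
    using kernel[of "x - y"] linear_diff[OF linear, of x y] by (simp add: c0_rel_def)
  define T where "T X = S (SOME x. x \<in> X)" for X
  have T: "T (c0_rel I `` {x}) = S x" for x
  proof -
    have "x \<in> c0_rel I `` {x}"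
      by (simp add: c0_rel_def c0_zero[OF I])
    then have "(SOME y. y \<in> c0_rel I `` {x}) \<in> c0_rel I `` {x}"
      by (rule someI[of "\<lambda>y. y \<in> c0_rel I `` {x}"])
    then show ?thesis
      unfolding T_def Image_singleton_iff S_eq[symmetric] by simp
  qed
  have "bij_betw T (quot I) UNIV"
  proof (rule bij_betwI')
    fix X Y assume "X \<in> quot I" "Y \<in> quot I"
    then obtain x y where xy: "X = c0_rel I `` {x}" "Y = c0_rel I `` {y}"
      by (meson quotE)
    show "(T X = T Y) = (X = Y)"
      unfolding xy T S_eq eq_equiv_class_iff[OF equiv_c0_rel[OF I] UNIV_I UNIV_I] ..
  next
    fix y :: linf
    obtain x where "y = S x"
      using \<open>surj S\<close> by blast
    then show "\<exists>X\<in>quot I. y = T X"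
      using T quot_class by metis
  qed simp
  moreover have "quot_linear I T"
    unfolding quot_linear_def
  proof (intro conjI ballI allI)
    fix X Y assume "X \<in> quot I" "Y \<in> quot I"
    then obtain x y where xy: "X = c0_rel I `` {x}" "Y = c0_rel I `` {y}"
      by (meson quotE)
    show "T (quot_add I X Y) = T X + T Y"
      unfolding xy quot_ops_class[OF I] T by (rule linear_add[OF linear])
  next
    fix X and r :: real assume "X \<in> quot I"
    then obtain x where x: "X = c0_rel I `` {x}"
      by (rule quotE)
    show "T (quot_scale I r X) = r *\<^sub>R T X"
      unfolding x quot_ops_class[OF I] T by (rule linear_cmul[OF linear])
  qed
  ultimately show thesis
    using T that by blast
qed

lemma quotient_operator_of_quot_linear:
  assumes I: "nat_ideal I" and bij: "bij_betw T (quot I) UNIV" and linear: "quot_linear I T"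
  shows "quotient_operator I (\<lambda>x. T (c0_rel I `` {x}))"
proof -
  let ?S = "\<lambda>x. T (c0_rel I `` {x})"
  have "?S (x + y) = ?S x + ?S y" for x y
    using linear quot_class quot_ops_class(1)[OF I] unfolding quot_linear_def by metis
  moreover have "?S (r *\<^sub>R x) = r *\<^sub>R ?S x" for r x
    using linear quot_class quot_ops_class(2)[OF I] unfolding quot_linear_def by metis
  ultimately have "linear ?S"
    by (rule linearI)
  moreover have "surj ?S"
  proof -
    have "quot I = range (\<lambda>x. c0_rel I `` {x})"
      by (auto simp: quot_def quotient_def)
    then show ?thesis
      using bij by (auto simp: bij_betw_def image_image)
  qed
  moreover have "?S x = 0 \<longleftrightarrow> x \<in> c0 I" for x
  proof -
    have "?S x = 0 \<longleftrightarrow> ?S x = ?S 0"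
      using linear_0[OF \<open>linear ?S\<close>] by simp
    also have "\<dots> \<longleftrightarrow> c0_rel I `` {x} = c0_rel I `` {0}"
      using inj_on_eq_iff[OF bij_betw_imp_inj_on[OF bij] quot_class quot_class] .
    also have "\<dots> \<longleftrightarrow> x \<in> c0 I"
      unfolding eq_equiv_class_iff[OF equiv_c0_rel[OF I] UNIV_I UNIV_I] by (simp add: c0_rel_def)
    finally show ?thesis .
  qed
  ultimately show ?thesis
    by (simp add: quotient_operator_def)
qed

lemma c0D: "x \<in> c0 I \<Longrightarrow> 0 < e \<Longrightarrow> {n. e \<le> \<bar>apply_bcontfun x n\<bar>} \<in> I"
  by (simp add: c0_def)

lemma bdd_below_norms: "bdd_below (norm ` X)"
  by (rule bdd_belowI[of _ 0]) auto

lemma quot_norm_le: "x \<in> X \<Longrightarrow> quot_norm X \<le> norm x"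
  unfolding quot_norm_def by (rule cINF_lower[OF bdd_below_norms])

lemma quot_norm_greatest: "X \<noteq> {} \<Longrightarrow> (\<And>x. x \<in> X \<Longrightarrow> b \<le> norm x) \<Longrightarrow> b \<le> quot_norm X"
  unfolding quot_norm_def by (rule cINF_greatest)

text \<open>A coset has norm at most \<open>b\<close> exactly when its representatives exceed \<open>b\<close> by a positive
  amount only on sets of the ideal. In one direction a representative is truncated at
  \<open>b\<close>, which changes it by a sequence in the kernel.\<close>

lemma quot_norm_le_iff:
  assumes I: "nat_ideal I" and "0 \<le> b"
  shows "quot_norm (c0_rel I `` {x}) \<le> b \<longleftrightarrow> (\<forall>e>0. {n. b + e \<le> \<bar>apply_bcontfun x n\<bar>} \<in> I)"
proof (intro iffI allI impI)
  fix e :: real assume le: "quot_norm (c0_rel I `` {x}) \<le> b" and "0 < e"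
  have "x \<in> c0_rel I `` {x}"
    by (simp add: c0_rel_def c0_zero[OF I])
  then have "norm ` (c0_rel I `` {x}) \<noteq> {}"
    by blast
  moreover have "(INF z\<in>c0_rel I `` {x}. norm z) < b + e / 2"
    using le \<open>0 < e\<close> unfolding quot_norm_def by simp
  ultimately obtain r where "r \<in> norm ` (c0_rel I `` {x})" "r < b + e / 2"
    by (meson cInf_lessD)
  then obtain z where z: "z \<in> c0_rel I `` {x}" "norm z < b + e / 2"
    by (elim imageE) simp
  have "{n. b + e \<le> \<bar>apply_bcontfun x n\<bar>} \<subseteq> {n. e / 2 \<le> \<bar>apply_bcontfun (x - z) n\<bar>}"
  proof
    fix n assume "n \<in> {n. b + e \<le> \<bar>apply_bcontfun x n\<bar>}"
    then show "n \<in> {n. e / 2 \<le> \<bar>apply_bcontfun (x - z) n\<bar>}"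
      using z(2) linf_abs_le_norm[of z n]
        abs_triangle_ineq2[of "apply_bcontfun x n" "apply_bcontfun z n"] by simp
  qed
  moreover have "{n. e / 2 \<le> \<bar>apply_bcontfun (x - z) n\<bar>} \<in> I"
    using z(1) \<open>0 < e\<close> by (intro c0D) (auto simp: c0_rel_def)
  ultimately show "{n. b + e \<le> \<bar>apply_bcontfun x n\<bar>} \<in> I"
    using ideal_subset[OF I] by blast
next
  assume small: "\<forall>e>0. {n. b + e \<le> \<bar>apply_bcontfun x n\<bar>} \<in> I"
  define z :: linf where "z = Bcontfun (\<lambda>n. max (- b) (min b (apply_bcontfun x n)))"
  have z: "apply_bcontfun z n = max (- b) (min b (apply_bcontfun x n))" for n
    unfolding z_def by (rule Bcontfun_apply[of _ b]) (use \<open>0 \<le> b\<close> in auto)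
  have "{n. e \<le> \<bar>apply_bcontfun (x - z) n\<bar>} = {n. b + e \<le> \<bar>apply_bcontfun x n\<bar>}" if "0 < e" for e
    using that \<open>0 \<le> b\<close> by (auto simp: z max_def min_def abs_if split: if_splits)
  then have "z \<in> c0_rel I `` {x}"
    using small by (simp add: c0_rel_def c0_def)
  moreover have "norm z \<le> b"
    by (rule linf_norm_le) (use \<open>0 \<le> b\<close> in \<open>auto simp: z\<close>)
  ultimately show "quot_norm (c0_rel I `` {x}) \<le> b"
    using quot_norm_le order_trans by blast
qed

context separated_ultrafilters
begin

lemma quotient_operator_coords: "quotient_operator I coords"
  unfolding quotient_operator_def
  using linear_coords coords_eq_0_iff surjI[of coords spread, OF coords_spread] by blast

text \<open>Limits do not exceed the norm of any representative, and the lift is a representative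
  that attains the norm of the limits.\<close>

lemma norm_coords:
  assumes I: "nat_ideal I"
  shows "norm (coords x) = quot_norm (c0_rel I `` {x})"
proof (rule antisym)
  have same: "z \<in> c0_rel I `` {x} \<longleftrightarrow> coords z = coords x" for z
    using coords_eq_0_iff[of "x - z"] linear_diff[OF linear_coords, of x z]
    by (auto simp: c0_rel_def)
  show "norm (coords x) \<le> quot_norm (c0_rel I `` {x})"
    using same by (intro quot_norm_greatest) (metis equals0D, metis norm_coords_le)
  show "quot_norm (c0_rel I `` {x}) \<le> norm (coords x)"
    using quot_norm_le[of "spread (coords x)"] norm_spread_le[of "coords x"] same coords_spread
    by (meson order_trans)
qed

lemma quot_isometric: "nat_ideal I \<Longrightarrow> quot_isometric_linf I"
  unfolding quot_isometric_linf_def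
  by (rule quotient_operator_factors[OF _ quotient_operator_coords]) (auto elim!: quotE simp: norm_coords)

lemma quot_lattice_isomorphic:
  assumes I: "nat_ideal I"
  shows "quot_lattice_isomorphic_linf I"
proof -
  obtain T where T: "bij_betw T (quot I) UNIV" "quot_linear I T"
    and factor: "\<And>x. T (c0_rel I `` {x}) = coords x"
    using quotient_operator_factors[OF I quotient_operator_coords] by blast
  show ?thesis
    unfolding quot_lattice_isomorphic_linf_def
  proof (intro exI[of _ T] conjI T exI[of _ 1] ballI)
    show "norm (T X) \<le> 1 * quot_norm X" if "X \<in> quot I" for X
      using that by (auto elim!: quotE simp: factor norm_coords[OF I])
    show "T (quot_sup I X Y) = linf_sup (T X) (T Y)" if "X \<in> quot I" "Y \<in> quot I" for X Y
      using that by (auto elim!: quotE simp: factor quot_ops_class[OF I] coords_sup)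
    show "T (quot_inf I X Y) = linf_inf (T X) (T Y)" if "X \<in> quot I" "Y \<in> quot I" for X Y
      using that by (auto elim!: quotE simp: factor quot_ops_class[OF I] coords_inf)
  qed
qed

end

section \<open>The space of ultrafilters above the dual filter\<close>

lemma openin_K_space_basic: "openin (K_space I) {q \<in> topspace (K_space I). A \<in> q}"
proof -
  have "{q \<in> topspace (K_space I). A \<in> q} =
      {q. nat_ultrafilter q \<and> A \<in> q} \<inter> {q. nat_ultrafilter q \<and> dual_filter I \<subseteq> q}"
    by (auto simp: K_space_def topspace_beta_nat)
  then show ?thesis
    unfolding K_space_def openin_subtopology using openin_beta_nat_basic[of A] by blast
qed

lemma openin_K_space_imp_basic:
  assumes U: "openin (K_space I) U" and "q \<in> U"
  obtains A where "A \<in> q" and "{r \<in> topspace (K_space I). A \<in> r} \<subseteq> U"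
proof -
  obtain V where V: "openin beta_nat V"
    and UV: "U = V \<inter> {q. nat_ultrafilter q \<and> dual_filter I \<subseteq> q}"
    using U by (auto simp: K_space_def openin_subtopology)
  have "q \<in> V"
    using \<open>q \<in> U\<close> UV by blast
  with V obtain A where "A \<in> q" and A: "{r. nat_ultrafilter r \<and> A \<in> r} \<subseteq> V"
    by (rule openin_beta_nat_imp_basic)
  moreover have "{r \<in> topspace (K_space I). A \<in> r} \<subseteq> U"
    using A by (auto simp: UV K_space_def topspace_beta_nat)
  ultimately show thesis
    using that by blast
qed

lemma continuous_map_beta_natI:
  assumes "\<And>x. x \<in> topspace X \<Longrightarrow> nat_ultrafilter (f x)"
    and "\<And>A. openin X {x \<in> topspace X. A \<in> f x}"
  shows "continuous_map X beta_nat f"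
  unfolding beta_nat_def
proof (rule continuous_on_generated_topo)
  fix U assume "U \<in> range (\<lambda>A. {p. nat_ultrafilter p \<and> A \<in> p})"
  then obtain A where "U = {p. nat_ultrafilter p \<and> A \<in> p}"
    by blast
  then have "f -` U \<inter> topspace X = {x \<in> topspace X. A \<in> f x}"
    using assms(1) by blast
  then show "openin X (f -` U \<inter> topspace X)"
    using assms(2) by simp
next
  show "f ` topspace X \<subseteq> (\<Union>A. {p. nat_ultrafilter p \<and> A \<in> p})"
    using assms(1) ultrafilter_UNIV by blast
qed

context separated_ultrafilters
begin

text \<open>The Boolean endomorphism that becomes \<open>T\<close> for the discrete projection below. It fixes
  the unions of fibres and sends every set to one that is equal to it modulo the ideal.\<close>

definition saturate :: "nat set \<Rightarrow> nat set" where
  "saturate A = c -` {n. A \<in> p n}"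

lemma saturate_vimage: "saturate (c -` E) = c -` E"
  by (simp add: saturate_def vimage_in_ultrafilter_iff)

lemma saturate_Int: "saturate (A \<inter> B) = saturate A \<inter> saturate B"
  by (auto simp: saturate_def ultrafilter_Int_iff[OF ultra])

lemma symmetric_difference_saturate: "(A - saturate A) \<union> (saturate A - A) \<in> I"
proof -
  have in_iff: "saturate A \<in> p n \<longleftrightarrow> A \<in> p n" for n
    unfolding saturate_def vimage_in_ultrafilter_iff by simp
  have "(A - saturate A) \<union> (saturate A - A) \<notin> p n" for n
    unfolding Diff_eq ultrafilter_Un_iff[OF ultra] ultrafilter_Int_iff[OF ultra]
      ultrafilter_Compl_iff[OF ultra] in_iff by blast
  then show ?thesis
    by (simp add: null)
qed

definition pushforward :: "nat set set \<Rightarrow> nat set set" where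
  "pushforward q = {E. c -` E \<in> q}"

definition ultra_sum :: "nat set set \<Rightarrow> nat set set" where
  "ultra_sum r = {A. {n. A \<in> p n} \<in> r}"

lemma ultrafilter_pushforward:
  assumes q: "nat_ultrafilter q"
  shows "nat_ultrafilter (pushforward q)"
  unfolding nat_ultrafilter_def
proof (intro conjI allI impI)
  show "UNIV \<in> pushforward q" "{} \<notin> pushforward q"
    by (simp_all add: pushforward_def ultrafilter_UNIV[OF q] ultrafilter_empty[OF q])
  show "B \<in> pushforward q" if "A \<in> pushforward q" "A \<subseteq> B" for A B
    using that(1) ultrafilter_superset[OF q _ vimage_mono[OF that(2)]] by (simp add: pushforward_def)
  show "A \<inter> B \<in> pushforward q" if "A \<in> pushforward q" "B \<in> pushforward q" for A B
    using that by (simp add: pushforward_def ultrafilter_Int_iff[OF q])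
  show "A \<in> pushforward q \<or> UNIV - A \<in> pushforward q" for A
    by (simp add: pushforward_def Compl_eq_Diff_UNIV[symmetric] vimage_Compl
        ultrafilter_Compl_iff[OF q])
qed

lemma ultrafilter_ultra_sum:
  assumes r: "nat_ultrafilter r"
  shows "nat_ultrafilter (ultra_sum r)"
  unfolding nat_ultrafilter_def
proof (intro conjI allI impI)
  show "UNIV \<in> ultra_sum r" "{} \<notin> ultra_sum r"
    using ultrafilter_UNIV[OF r] ultrafilter_empty[OF r]
    by (simp_all add: ultra_sum_def ultrafilter_UNIV[OF ultra] ultrafilter_empty[OF ultra])
  show "B \<in> ultra_sum r" if "A \<in> ultra_sum r" "A \<subseteq> B" for A B
  proof -
    have "{n. A \<in> p n} \<subseteq> {n. B \<in> p n}"
      using ultrafilter_superset[OF ultra _ \<open>A \<subseteq> B\<close>] by blast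
    then show ?thesis
      using that(1) ultrafilter_superset[OF r] by (simp add: ultra_sum_def)
  qed
  show "A \<inter> B \<in> ultra_sum r" if "A \<in> ultra_sum r" "B \<in> ultra_sum r" for A B
    using that unfolding ultra_sum_def
    by (simp add: ultrafilter_Int_iff[OF ultra] Collect_conj_eq ultrafilter_Int_iff[OF r])
  show "A \<in> ultra_sum r \<or> UNIV - A \<in> ultra_sum r" for A
    unfolding ultra_sum_def Compl_eq_Diff_UNIV[symmetric]
    by (simp add: ultrafilter_Compl_iff[OF ultra] Collect_neg_eq ultrafilter_Compl_iff[OF r])
qed

lemma ultra_sum_in_K_space:
  assumes r: "nat_ultrafilter r"
  shows "ultra_sum r \<in> topspace (K_space I)"
  unfolding topspace_K_space
  using ultrafilter_ultra_sum[OF r] ultrafilter_empty[OF r] by (auto simp: ultra_sum_def null)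

text \<open>The ultrafilters \<open>p n\<close> play the part of the points of the natural numbers: an ultrafilter
  on the indices gives the limit of the \<open>p n\<close> along it, and conversely the image under
  \<open>c\<close> recovers the ultrafilter on the indices. That a member of the space is the limit along its
  own image says that it does not distinguish a set from its saturation.\<close>

lemma K_space_homeomorphic: "K_space I homeomorphic_space beta_nat"
  unfolding homeomorphic_space_def homeomorphic_maps_def
proof (rule exI[of _ pushforward], rule exI[of _ ultra_sum], intro conjI ballI)
  show "continuous_map (K_space I) beta_nat pushforward"
  proof (rule continuous_map_beta_natI)
    show "nat_ultrafilter (pushforward q)" if "q \<in> topspace (K_space I)" for q
      using that by (simp add: topspace_K_space ultrafilter_pushforward)
    show "openin (K_space I) {q \<in> topspace (K_space I). A \<in> pushforward q}" for A
      unfolding pushforward_def mem_Collect_eq by (rule openin_K_space_basic)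
  qed
  have "continuous_map beta_nat beta_nat ultra_sum"
  proof (rule continuous_map_beta_natI)
    show "nat_ultrafilter (ultra_sum r)" if "r \<in> topspace beta_nat" for r
      using that by (simp add: topspace_beta_nat ultrafilter_ultra_sum)
    show "openin beta_nat {r \<in> topspace beta_nat. A \<in> ultra_sum r}" for A
      using openin_beta_nat_basic[of "{n. A \<in> p n}"] by (simp add: topspace_beta_nat ultra_sum_def)
  qed
  moreover have "ultra_sum ` topspace beta_nat \<subseteq> topspace (K_space I)"
    using ultra_sum_in_K_space by (auto simp: topspace_beta_nat)
  ultimately show "continuous_map beta_nat (K_space I) ultra_sum"
    unfolding K_space_def by (auto simp: continuous_map_in_subtopology)
next
  fix q assume "q \<in> topspace (K_space I)"
  then have q: "nat_ultrafilter q" and "I \<subseteq> - q"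
    by (auto simp: topspace_K_space)
  have "saturate A \<in> q \<longleftrightarrow> A \<in> q" for A
  proof -
    have "(A - saturate A) \<union> (saturate A - A) \<notin> q"
      using symmetric_difference_saturate \<open>I \<subseteq> - q\<close> by blast
    then show ?thesis
      unfolding Diff_eq ultrafilter_Un_iff[OF q] ultrafilter_Int_iff[OF q]
        ultrafilter_Compl_iff[OF q] by blast
  qed
  then show "ultra_sum (pushforward q) = q"
    unfolding ultra_sum_def pushforward_def saturate_def mem_Collect_eq by simp
next
  show "pushforward (ultra_sum r) = r" for r
    by (simp add: pushforward_def ultra_sum_def vimage_in_ultrafilter_iff)
qed

end

text \<open>Under a homeomorphism the principal ultrafilters become a dense set of isolated points.
  Isolation is discreteness of the family; density makes a set that no member of the family
  contains disjoint from every ultrafilter of the space, hence a member of the ideal.\<close>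

lemma homeomorphic_imp_discrete_family:
  assumes I: "nat_ideal I" and "K_space I homeomorphic_space beta_nat"
  shows "\<exists>p. discrete_ultrafilter_family I p"
proof -
  obtain f g where "homeomorphic_maps (K_space I) beta_nat f g"
    using assms(2) by (auto simp: homeomorphic_space_def)
  then have f: "continuous_map (K_space I) beta_nat f"
    and g: "continuous_map beta_nat (K_space I) g"
    and gf: "\<And>q. q \<in> topspace (K_space I) \<Longrightarrow> g (f q) = q"
    and fg: "\<And>r. nat_ultrafilter r \<Longrightarrow> f (g r) = r"
    by (auto simp: homeomorphic_maps_def topspace_beta_nat)
  define principal where "principal n = {A :: nat set. n \<in> A}" for n
  have principal: "nat_ultrafilter (principal n)" for n
    unfolding principal_def by (rule ultrafilter_principal)
  define p where "p n = g (principal n)" for n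
  have in_K: "p n \<in> topspace (K_space I)" for n
    using continuous_map_image_subset_topspace[OF g] principal[of n]
    by (auto simp: p_def topspace_beta_nat)
  have f_p: "f (p n) = principal n" for n
    by (simp add: p_def fg principal)
  have "discrete_ultrafilter_family I p"
  proof (rule discrete_ultrafilter_familyI)
    show "nat_ultrafilter (p n)" for n
      using in_K by (simp add: topspace_K_space)
    show "\<exists>A. \<forall>m. A \<in> p m \<longleftrightarrow> m = n" for n
    proof -
      have "openin (K_space I) {q \<in> topspace (K_space I). f q \<in> {r. nat_ultrafilter r \<and> {n} \<in> r}}"
        by (rule openin_continuous_map_preimage[OF f openin_beta_nat_basic])
      moreover have "p n \<in> {q \<in> topspace (K_space I). f q \<in> {r. nat_ultrafilter r \<and> {n} \<in> r}}"
        using in_K principal by (simp add: f_p) (simp add: principal_def)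
      ultimately obtain A where "A \<in> p n" and A: "{q \<in> topspace (K_space I). A \<in> q} \<subseteq>
          {q \<in> topspace (K_space I). f q \<in> {r. nat_ultrafilter r \<and> {n} \<in> r}}"
        by (rule openin_K_space_imp_basic)
      have "m = n" if "A \<in> p m" for m
      proof -
        have "{n} \<in> f (p m)"
          using A in_K that by auto
        then show ?thesis
          by (simp add: f_p) (simp add: principal_def)
      qed
      with \<open>A \<in> p n\<close> show ?thesis
        by blast
    qed
    show "B \<in> I \<longleftrightarrow> (\<forall>n. B \<notin> p n)" for B
    proof
      show "\<forall>n. B \<notin> p n" if "B \<in> I"
        using that in_K ideal_eq_K_space_null_sets[OF I] by blast
      assume B: "\<forall>n. B \<notin> p n"
      let ?U = "{r \<in> topspace beta_nat. g r \<in> {q \<in> topspace (K_space I). B \<in> q}}"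
      have U: "openin beta_nat ?U"
        by (rule openin_continuous_map_preimage[OF g openin_K_space_basic])
      show "B \<in> I"
      proof (rule ccontr)
        assume "B \<notin> I"
        then obtain q where q: "q \<in> topspace (K_space I)" "B \<in> q"
          using ideal_eq_K_space_null_sets[OF I] by blast
        then have "f q \<in> ?U"
          using gf continuous_map_image_subset_topspace[OF f] by auto
        with U obtain E where "E \<in> f q" and E: "{r. nat_ultrafilter r \<and> E \<in> r} \<subseteq> ?U"
          by (rule openin_beta_nat_imp_basic)
        moreover have "nat_ultrafilter (f q)"
          using \<open>f q \<in> ?U\<close> by (simp add: topspace_beta_nat)
        ultimately obtain n where "n \<in> E"
          using ultrafilter_empty by fastforce
        then have "principal n \<in> ?U"
          using subsetD[OF E, of "principal n"] principal[of n] by (simp add: principal_def)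
        then show False
          using B by (simp add: p_def)
      qed
    qed
  qed
  then show ?thesis
    by blast
qed

section \<open>Discrete projections\<close>

lemma chi_inject: "chi A = chi B \<longleftrightarrow> A = B"
proof
  assume "chi A = chi B"
  then have "indicator A n = (indicator B n :: real)" for n
    using chi_apply by metis
  then show "A = B"
    by (metis indicator_eq_1_iff subsetI subset_antisym)
qed simp

lemma chi_empty: "chi {} = 0"
  by (rule bcontfun_eqI) (simp add: chi_apply)

lemma chi_eq_0_iff: "chi A = 0 \<longleftrightarrow> A = {}"
  using chi_inject[of A "{}"] by (simp add: chi_empty)

lemma chi_disjoint_Un: "A \<inter> B = {} \<Longrightarrow> chi (A \<union> B) = chi A + chi B"
  by (rule bcontfun_eqI) (auto simp: chi_apply indicator_def)

lemma chi_in_c0_iff: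
  assumes I: "nat_ideal I"
  shows "chi B \<in> c0 I \<longleftrightarrow> B \<in> I"
proof
  assume "chi B \<in> c0 I"
  then have "{n. 1 \<le> \<bar>apply_bcontfun (chi B) n\<bar>} \<in> I"
    by (rule c0D) simp
  also have "{n. 1 \<le> \<bar>apply_bcontfun (chi B) n\<bar>} = B"
    by (auto simp: chi_apply indicator_def split: if_splits)
  finally show "B \<in> I" .
next
  assume "B \<in> I"
  have "{n. e \<le> \<bar>apply_bcontfun (chi B) n\<bar>} \<subseteq> B" if "0 < e" for e
    using that by (auto simp: chi_apply indicator_def split: if_splits)
  with \<open>B \<in> I\<close> show "chi B \<in> c0 I"
    unfolding c0_def using ideal_subset[OF I] by blast
qed

context separated_ultrafilters
begin

definition fibre_projection :: "linf \<Rightarrow> linf" where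
  "fibre_projection x = spread (coords x)"

lemma bounded_linear_fibre_projection: "bounded_linear fibre_projection"
proof (rule bounded_linear_intro[where K = 1])
  show "fibre_projection (x + y) = fibre_projection x + fibre_projection y" for x y
    by (rule bcontfun_eqI) (simp add: fibre_projection_def spread_apply coords_add)
  show "fibre_projection (r *\<^sub>R x) = r *\<^sub>R fibre_projection x" for r x
    by (rule bcontfun_eqI) (simp add: fibre_projection_def spread_apply coords_scaleR)
  show "norm (fibre_projection x) \<le> norm x * 1" for x
    unfolding fibre_projection_def
    using order_trans[OF norm_spread_le[of "coords x"] norm_coords_le[of x]] by simp
qed

lemma discrete_projection_fibre_projection: "discrete_projection I fibre_projection"
  unfolding discrete_projection_def
proof (intro conjI allI impI bounded_linear_fibre_projection exI[of _ saturate])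
  show "fibre_projection (fibre_projection x) = fibre_projection x" for x
    by (simp add: fibre_projection_def coords_spread)
  show "linf_nonneg (fibre_projection x)" if "linf_nonneg x" for x
  proof -
    have "linf_sup x 0 = x"
      using that by (intro bcontfun_eqI) (simp add: linf_sup_apply linf_nonneg_def)
    then have "coords x = linf_sup (coords x) (coords 0)"
      by (metis coords_sup)
    then have "0 \<le> apply_bcontfun (coords x) n" for n
      using linear_0[OF linear_coords]
      by (metis linf_sup_apply max.cobounded2 zero_bcontfun.rep_eq)
    then show ?thesis
      by (simp add: linf_nonneg_def fibre_projection_def spread_apply)
  qed
  show "{x. fibre_projection x = 0} = c0 I"
  proof -
    have "fibre_projection x = 0 \<longleftrightarrow> coords x = 0" for x
      using coords_spread linear_0[OF linear_coords]
      by (metis bcontfun_eqI fibre_projection_def spread_apply zero_bcontfun.rep_eq)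
    then show ?thesis
      by (simp add: coords_eq_0_iff)
  qed
  show "fibre_projection (chi A) = chi (saturate A)" for A
    unfolding fibre_projection_def coords_chi spread_chi saturate_def ..
  show "saturate (A \<inter> B) = saturate A \<inter> saturate B" for A B
    by (rule saturate_Int)
  show "\<Inter>F \<in> {B. saturate B = B}" if "F \<subseteq> {B. saturate B = B}" for F
  proof -
    have "B = c -` {n. B \<in> p n}" if "B \<in> F" for B
      using that \<open>F \<subseteq> {B. saturate B = B}\<close> unfolding saturate_def by blast
    then have "\<Inter>F = c -` (\<Inter>B\<in>F. {n. B \<in> p n})"
      unfolding vimage_INT by (metis (no_types, lifting) image_cong image_ident)
    then show ?thesis
      by (simp only: mem_Collect_eq saturate_vimage)
  qed
qed

text \<open>The indicators of the fibres are independent: the \<open>n\<close>-th coordinate vanishes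
  at all of them but the \<open>n\<close>-th.\<close>

lemma infinite_rank_fibre_projection: "infinite_rank fibre_projection"
  unfolding infinite_rank_def
proof (intro notI, elim exE conjE)
  fix B assume "finite B" and rank: "range fibre_projection \<subseteq> span B"
  let ?v = "\<lambda>n. spread (chi {n})"
  have coords_v: "apply_bcontfun (coords (?v m)) n = indicator {m} n" for m n
    by (simp add: coords_spread chi_apply)
  then have "inj ?v"
    by (intro injI) (metis chi_inject coords_spread singleton_inject)
  have "independent (range ?v)"
    unfolding dependent_def
  proof (intro notI, elim bexE)
    fix a assume "a \<in> range ?v" and span: "a \<in> span (range ?v - {a})"
    then obtain n where a: "a = ?v n"
      by blast
    let ?f = "\<lambda>x. apply_bcontfun (coords x) n"
    have "linear ?f"
      by (rule linearI) (simp_all add: coords_add coords_scaleR)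
    moreover have "?f x = 0" if "x \<in> range ?v - {a}" for x
      using that coords_v by (auto simp: a indicator_def)
    ultimately have "?f a = 0"
      using span by (rule linear_eq_0_on_span)
    then show False
      by (simp add: a coords_v)
  qed
  moreover have "range ?v \<subseteq> span B"
  proof -
    have "?v n = fibre_projection (?v n)" for n
      by (simp add: fibre_projection_def coords_spread)
    then show ?thesis
      using rank by blast
  qed
  ultimately have "finite (range ?v)"
    using independent_span_bound[OF \<open>finite B\<close>] by blast
  then show False
    using \<open>inj ?v\<close> by (simp add: finite_image_iff)
qed

lemma strongly_complemented: "strongly_complemented I"
  unfolding strongly_complemented_def
  using discrete_projection_fibre_projection infinite_rank_fibre_projection by blast

end

text \<open>A positive operator that sends indicators to indicators is a family of limits: around the
  limit along the ultrafilter of all \<open>A\<close> with \<open>k \<in> T A\<close>, the sequence is within \<open>e\<close>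
  on a set \<open>A\<close> of the ultrafilter, and on the complement of \<open>A\<close> it is dominated by a multiple of an
  indicator whose image vanishes at \<open>k\<close>.\<close>

lemma positive_operator_eq_ultra_limit:
  assumes linear: "linear Q" and pos: "\<And>x. linf_nonneg x \<Longrightarrow> linf_nonneg (Q x)"
    and chi: "\<And>A. Q (chi A) = chi (T A)"
    and ultra: "nat_ultrafilter {A. k \<in> T A}"
  shows "apply_bcontfun (Q x) k = ultra_limit {A. k \<in> T A} x"
proof -
  let ?p = "{A. k \<in> T A}"
  let ?l = "ultra_limit ?p x"
  have "\<bar>apply_bcontfun (Q x) k - ?l\<bar> \<le> e" if "0 < e" for e
  proof -
    define A where "A = {n. \<bar>apply_bcontfun x n - ?l\<bar> < e}"
    have "A \<in> ?p"
      using tendstoD[OF tendsto_ultra_limit[OF ultra, of x] \<open>0 < e\<close>]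
      by (simp only: eventually_ultra_filter[OF ultra] dist_real_def A_def)
    then have "k \<in> T UNIV" "k \<notin> T (- A)"
      using ultrafilter_UNIV[OF ultra] ultrafilter_Compl_iff[OF ultra, of A] by simp_all
    \<comment> \<open>A bound for the distance from \<open>x\<close> to its limit on the complement of \<open>A\<close>.\<close>
    define b where "b = norm x + \<bar>?l\<bar>"
    define w where "w = e *\<^sub>R chi UNIV + b *\<^sub>R chi (- A)"
    have w: "\<bar>apply_bcontfun x n - ?l\<bar> \<le> apply_bcontfun w n" for n
    proof (cases "n \<in> A")
      case True
      then show ?thesis
        by (simp add: w_def chi_apply) (simp add: A_def)
    next
      case False
      then show ?thesis
        using linf_abs_le_norm[of x n] \<open>0 < e\<close> by (simp add: w_def chi_apply b_def)
    qed
    have Q_w: "apply_bcontfun (Q w) k = e"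
      using \<open>k \<in> T UNIV\<close> \<open>k \<notin> T (- A)\<close>
      by (simp add: w_def linear_add[OF linear] linear_cmul[OF linear] chi chi_apply)
    have Q_1: "apply_bcontfun (Q (?l *\<^sub>R chi UNIV)) k = ?l"
      using \<open>k \<in> T UNIV\<close> by (simp add: linear_cmul[OF linear] chi chi_apply)
    have "linf_nonneg (w - (x - ?l *\<^sub>R chi UNIV))" "linf_nonneg (w + (x - ?l *\<^sub>R chi UNIV))"
      unfolding linf_nonneg_def using w by (auto simp: chi_apply abs_le_iff algebra_simps)
    from pos[OF this(1)] pos[OF this(2)] have "0 \<le> apply_bcontfun (Q (w - (x - ?l *\<^sub>R chi UNIV))) k"
      "0 \<le> apply_bcontfun (Q (w + (x - ?l *\<^sub>R chi UNIV))) k"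
      unfolding linf_nonneg_def by blast+
    then show ?thesis
      unfolding linear_add[OF linear] linear_diff[OF linear] by (simp add: Q_w Q_1 abs_le_iff)
  qed
  then have "\<bar>apply_bcontfun (Q x) k - ?l\<bar> \<le> 0"
    by (rule dense_ge)
  then show ?thesis
    by simp
qed

text \<open>The map \<open>T\<close> is a Boolean endomorphism, so every \<open>k\<close> defines the ultrafilter of all
  \<open>A\<close> with \<open>k \<in> T A\<close>. The smallest fixed set around \<open>k\<close> exists because fixed sets are closed
  under intersections; it is an atom of the algebra of fixed sets, and it isolates the ultrafilter.
  Finitely many ultrafilters would make the rank finite, because the values of the projection are
  limits along them.\<close>

lemma strongly_complemented_imp_discrete_family:
  assumes I: "nat_ideal I" and "strongly_complemented I"
  shows "\<exists>p. discrete_ultrafilter_family I p"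
proof -
  obtain Q where projection: "discrete_projection I Q" and rank: "infinite_rank Q"
    using assms(2) unfolding strongly_complemented_def by blast
  have linear: "linear Q" and idem: "Q (Q x) = Q x"
    and pos: "linf_nonneg x \<Longrightarrow> linf_nonneg (Q x)"
    and kernel: "{x. Q x = 0} = c0 I" for x
    using projection by (simp_all add: discrete_projection_def bounded_linear.linear)
  obtain T where chi: "\<And>A. Q (chi A) = chi (T A)"
    and T_Int: "\<And>A B. T (A \<inter> B) = T A \<inter> T B"
    and T_Inter: "\<And>F. F \<subseteq> {B. T B = B} \<Longrightarrow> \<Inter>F \<in> {B. T B = B}"
  proof -
    have "\<exists>T. (\<forall>A. Q (chi A) = chi (T A)) \<and> (\<forall>A B. T (A \<inter> B) = T A \<inter> T B) \<and>
        (\<forall>F. F \<subseteq> {B. T B = B} \<longrightarrow> \<Inter>F \<in> {B. T B = B})"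
      using projection unfolding discrete_projection_def by (elim conjE)
    then obtain T where T: "(\<forall>A. Q (chi A) = chi (T A)) \<and> (\<forall>A B. T (A \<inter> B) = T A \<inter> T B) \<and>
        (\<forall>F. F \<subseteq> {B. T B = B} \<longrightarrow> \<Inter>F \<in> {B. T B = B})"
      by (rule exE)
    show thesis
      by (rule that[of T]) (use T in simp_all)
  qed
  have T_UNIV: "T UNIV = UNIV"
    using T_Inter[of "{}"] by simp
  have T_empty: "T {} = {}"
    using chi[of "{}"] linear_0[OF linear] by (simp add: chi_empty chi_eq_0_iff)
  have T_T: "T (T A) = T A" for A
    using idem[of "chi A"] by (simp add: chi chi_inject)
  have T_Compl: "k \<in> T (- A) \<longleftrightarrow> k \<notin> T A" for A k
  proof -
    have "chi UNIV = chi A + chi (- A)"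
      using chi_disjoint_Un[of A "- A"] by simp
    then have "chi (T UNIV) = chi (T A) + chi (T (- A))"
      by (metis chi linear_add[OF linear])
    then have "apply_bcontfun (chi UNIV) k = apply_bcontfun (chi (T A) + chi (T (- A))) k"
      by (simp add: T_UNIV)
    then show ?thesis
      by (auto simp: chi_apply indicator_def split: if_splits)
  qed
  define p where "p k = {A. k \<in> T A}" for k
  have ultra: "nat_ultrafilter (p k)" for k
    unfolding nat_ultrafilter_def
  proof (intro conjI allI impI)
    show "UNIV \<in> p k" "{} \<notin> p k"
      by (simp_all add: p_def T_UNIV T_empty)
    show "B \<in> p k" if "A \<in> p k" "A \<subseteq> B" for A B
      using that T_Int[of A B] by (auto simp: p_def Int_absorb2)
    show "A \<inter> B \<in> p k" if "A \<in> p k" "B \<in> p k" for A B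
      using that by (simp add: p_def T_Int)
    show "A \<in> p k \<or> UNIV - A \<in> p k" for A
      using T_Compl by (simp add: p_def Compl_eq_Diff_UNIV[symmetric])
  qed
  have null: "B \<in> I \<longleftrightarrow> (\<forall>k. B \<notin> p k)" for B
  proof -
    have "B \<in> I \<longleftrightarrow> Q (chi B) = 0"
      unfolding chi_in_c0_iff[OF I, symmetric] kernel[symmetric] by simp
    then show ?thesis
      by (auto simp: chi chi_eq_0_iff p_def)
  qed
  have isolated: "\<exists>A. \<forall>m. A \<in> p m \<longleftrightarrow> p m = p k" for k
  proof -
    define a where "a = \<Inter> {B. T B = B \<and> k \<in> B}"
    have "T a = a"
      using T_Inter[of "{B. T B = B \<and> k \<in> B}"] unfolding a_def by blast
    have "k \<in> a"
      unfolding a_def by blast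
    have in_a: "m \<in> B" if "m \<in> a" "T B = B" "k \<in> B" for m B
      using that unfolding a_def by blast
    have "a \<in> p m \<longleftrightarrow> p m = p k" for m
    proof
      assume "a \<in> p m"
      then have "m \<in> a"
        by (simp add: p_def \<open>T a = a\<close>)
      have "m \<in> T A" if "k \<in> T A" for A
        using in_a[OF \<open>m \<in> a\<close> T_T that] .
      then show "p m = p k"
        unfolding p_def using T_Compl by blast
    next
      assume "p m = p k"
      moreover have "a \<in> p k"
        by (simp add: p_def \<open>T a = a\<close> \<open>k \<in> a\<close>)
      ultimately show "a \<in> p m"
        by simp
    qed
    then show ?thesis
      by blast
  qed
  have "infinite (range p)"
  proof
    assume fin: "finite (range p)"
    let ?B = "(\<lambda>q. chi {k. p k = q}) ` range p"
    have "Q x \<in> span ?B" for x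
    proof -
      have "Q x = (\<Sum>q\<in>range p. ultra_limit q x *\<^sub>R chi {k. p k = q})" (is "_ = ?s")
      proof (rule bcontfun_eqI)
        fix k
        have "linear (\<lambda>y :: linf. apply_bcontfun y k)"
          by (rule linearI) simp_all
        then have "apply_bcontfun ?s k =
            (\<Sum>q\<in>range p. apply_bcontfun (ultra_limit q x *\<^sub>R chi {k. p k = q}) k)"
          by (rule linear_sum)
        also have "\<dots> = (\<Sum>q\<in>range p. if q = p k then ultra_limit q x else 0)"
          by (rule sum.cong) (auto simp: chi_apply indicator_def)
        also have "\<dots> = ultra_limit (p k) x"
          using fin by simp
        also have "\<dots> = apply_bcontfun (Q x) k"
          unfolding p_def
          by (rule positive_operator_eq_ultra_limit[OF linear pos chi, symmetric])
            (use ultra in \<open>simp_all add: p_def\<close>)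
        finally show "apply_bcontfun (Q x) k = apply_bcontfun ?s k" ..
      qed
      moreover have "?s \<in> span ?B"
        by (intro span_sum span_scale span_base) blast
      ultimately show ?thesis
        by simp
    qed
    moreover have "finite ?B"
      using fin by simp
    ultimately show False
      using rank unfolding infinite_rank_def by blast
  qed
  then have "discrete_ultrafilter_family I p"
    unfolding discrete_ultrafilter_family_def using ultra isolated null by blast
  then show ?thesis
    by blast
qed

section \<open>Operators that preserve absolute values\<close>

definition linf_abs :: "linf \<Rightarrow> linf" where
  "linf_abs x = linf_sup x (- x)"

lemma linf_abs_apply: "apply_bcontfun (linf_abs x) n = \<bar>apply_bcontfun x n\<bar>"
  by (simp add: linf_abs_def linf_sup_apply abs_real_def max_def)

locale abs_preserving_quotient =
  fixes I :: "nat set set" and S :: "linf \<Rightarrow> linf"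
  assumes ideal: "nat_ideal I" and quotient: "quotient_operator I S"
    and S_abs: "S (linf_abs x) = linf_abs (S x)"
begin

lemma linear_S: "linear S"
  using quotient by (simp add: quotient_operator_def)

lemma S_preimage:
  obtains x where "S x = y"
  using quotient unfolding quotient_operator_def by (metis surjD)

lemma S_mono:
  assumes "\<And>k. apply_bcontfun x k \<le> apply_bcontfun y k"
  shows "apply_bcontfun (S x) n \<le> apply_bcontfun (S y) n"
proof -
  have "y - x = linf_abs (y - x)"
    using assms by (intro bcontfun_eqI) (simp add: linf_abs_apply)
  then have "S y - S x = linf_abs (S y - S x)"
    using S_abs linear_diff[OF linear_S] by metis
  then have "apply_bcontfun (S y - S x) n \<ge> 0"
    by (metis abs_ge_zero linf_abs_apply)
  then show ?thesis
    by simp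
qed

lemma S_chi_nonneg: "0 \<le> apply_bcontfun (S (chi A)) n"
  using S_mono[of 0 "chi A" n] linear_0[OF linear_S] by (simp add: chi_apply)

lemma S_bound: "apply_bcontfun (S x) n \<le> norm x * apply_bcontfun (S (chi UNIV)) n"
proof -
  have "apply_bcontfun (S x) n \<le> apply_bcontfun (S (norm x *\<^sub>R chi UNIV)) n"
    using linf_abs_le_norm[of x] by (intro S_mono) (auto simp: chi_apply abs_le_iff)
  then show ?thesis
    by (simp add: linear_cmul[OF linear_S])
qed

lemma S_unit_pos: "0 < apply_bcontfun (S (chi UNIV)) n"
proof -
  obtain x where "S x = chi UNIV"
    by (rule S_preimage)
  then have "1 \<le> norm x * apply_bcontfun (S (chi UNIV)) n"
    using S_bound[of x n] by (simp add: chi_apply)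
  then show ?thesis
    using S_chi_nonneg[of UNIV n] by (cases "apply_bcontfun (S (chi UNIV)) n = 0") auto
qed

lemma S_chi_disjoint:
  assumes "A \<inter> B = {}"
  shows "apply_bcontfun (S (chi A)) n = 0 \<or> apply_bcontfun (S (chi B)) n = 0"
proof -
  have "linf_abs (chi A - chi B) = chi A + chi B"
    using assms by (intro bcontfun_eqI) (auto simp: linf_abs_apply chi_apply indicator_def)
  then have "linf_abs (S (chi A) - S (chi B)) = S (chi A) + S (chi B)"
    using S_abs linear_diff[OF linear_S] linear_add[OF linear_S] by metis
  then have "\<bar>apply_bcontfun (S (chi A)) n - apply_bcontfun (S (chi B)) n\<bar> =
      apply_bcontfun (S (chi A)) n + apply_bcontfun (S (chi B)) n"
    by (metis linf_abs_apply minus_bcontfun.rep_eq plus_bcontfun.rep_eq)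
  then show ?thesis
    by linarith
qed

lemma S_chi_split:
  assumes "A \<inter> B = {}"
  shows "apply_bcontfun (S (chi (A \<union> B))) n =
    apply_bcontfun (S (chi A)) n + apply_bcontfun (S (chi B)) n"
  using chi_disjoint_Un[OF assms] linear_add[OF linear_S] by simp

definition support :: "nat \<Rightarrow> nat set set" where
  "support n = {A. apply_bcontfun (S (chi A)) n \<noteq> 0}"

text \<open>A coordinate of the operator is a lattice homomorphism to the reals. It cannot charge two
  disjoint sets, while the values at a set and at its complement add up to the positive value at the
  unit.\<close>

lemma ultrafilter_support: "nat_ultrafilter (support n)"
  unfolding nat_ultrafilter_def
proof (intro conjI allI impI)
  show "UNIV \<in> support n"
    using S_unit_pos[of n] by (simp add: support_def)
  show "{} \<notin> support n"
    by (simp add: support_def chi_empty linear_0[OF linear_S])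
  show "B \<in> support n" if "A \<in> support n" "A \<subseteq> B" for A B
  proof -
    have "A \<union> (B - A) = B"
      using that(2) by blast
    then show ?thesis
      using that(1) S_chi_split[of A "B - A" n] S_chi_nonneg[of A n] S_chi_nonneg[of "B - A" n]
      by (simp add: support_def)
  qed
  show "A \<inter> B \<in> support n" if "A \<in> support n" "B \<in> support n" for A B
  proof -
    have "A \<inter> B \<union> (A - B) = A"
      by blast
    then have "apply_bcontfun (S (chi A)) n =
        apply_bcontfun (S (chi (A \<inter> B))) n + apply_bcontfun (S (chi (A - B))) n"
      using S_chi_split[of "A \<inter> B" "A - B" n] by auto
    moreover have "apply_bcontfun (S (chi (A - B))) n = 0"
      using S_chi_disjoint[of "A - B" B n] that(2) by (auto simp: support_def)
    ultimately show ?thesis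
      using that(1) by (simp add: support_def)
  qed
  show "A \<in> support n \<or> UNIV - A \<in> support n" for A
    using S_chi_split[of A "- A" n] S_unit_pos[of n]
    by (auto simp: support_def Compl_eq_Diff_UNIV[symmetric])
qed

text \<open>Take a positive preimage of the \<open>n\<close>-th unit vector: where it
  is at least \<open>e\<close> it dominates a multiple of an indicator, so no other coordinate charges this
  set, and where it is below \<open>e\<close> it contributes at most half of the \<open>n\<close>-th coordinate.\<close>

lemma support_isolated: "\<exists>A. \<forall>m. A \<in> support m \<longleftrightarrow> m = n"
proof -
  obtain x where x: "S x = chi {n}"
    by (rule S_preimage)
  define y where "y = linf_abs x"
  have S_y: "S y = chi {n}"
    unfolding y_def S_abs x by (rule bcontfun_eqI) (simp add: linf_abs_apply chi_apply)
  have y_nonneg: "0 \<le> apply_bcontfun y k" for k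
    by (simp add: y_def linf_abs_apply)
  define u where "u = apply_bcontfun (S (chi UNIV)) n"
  define e where "e = 1 / (2 * u)"
  have "0 < u"
    unfolding u_def by (rule S_unit_pos)
  then have "0 < e" "e * u = 1 / 2"
    by (simp_all add: e_def)
  define A where "A = {k. e \<le> apply_bcontfun y k}"
  have "m = n" if "A \<in> support m" for m
  proof (rule ccontr)
    assume "m \<noteq> n"
    have "apply_bcontfun (S (e *\<^sub>R chi A)) m \<le> apply_bcontfun (S y) m"
      using y_nonneg by (intro S_mono) (simp add: chi_apply A_def indicator_def)
    then have "e * apply_bcontfun (S (chi A)) m \<le> 0"
      using \<open>m \<noteq> n\<close> by (simp add: linear_cmul[OF linear_S] S_y chi_apply)
    then have "apply_bcontfun (S (chi A)) m = 0"
      using \<open>0 < e\<close> S_chi_nonneg[of A m] by (simp add: mult_le_0_iff)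
    then show False
      using that by (simp add: support_def)
  qed
  moreover have "A \<in> support n"
  proof -
    have "apply_bcontfun (S y) n \<le> apply_bcontfun (S (e *\<^sub>R chi UNIV + norm y *\<^sub>R chi A)) n"
    proof (rule S_mono)
      show "apply_bcontfun y k \<le> apply_bcontfun (e *\<^sub>R chi UNIV + norm y *\<^sub>R chi A) k" for k
        using linf_abs_le_norm[of y k] \<open>0 < e\<close> by (auto simp: chi_apply A_def indicator_def)
    qed
    then have "1 \<le> e * u + norm y * apply_bcontfun (S (chi A)) n"
      by (simp add: linear_add[OF linear_S] linear_cmul[OF linear_S] S_y chi_apply u_def)
    then show ?thesis
      using \<open>e * u = 1 / 2\<close> by (auto simp: support_def)
  qed
  ultimately show ?thesis
    by blast
qed

lemma discrete_family_support: "discrete_ultrafilter_family I support"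
proof (rule discrete_ultrafilter_familyI)
  show "nat_ultrafilter (support n)" for n
    by (rule ultrafilter_support)
  show "\<exists>A. \<forall>m. A \<in> support m \<longleftrightarrow> m = n" for n
    by (rule support_isolated)
  show "B \<in> I \<longleftrightarrow> (\<forall>n. B \<notin> support n)" for B
  proof -
    have "B \<in> I \<longleftrightarrow> S (chi B) = 0"
      using quotient chi_in_c0_iff[OF ideal] by (simp add: quotient_operator_def)
    also have "\<dots> \<longleftrightarrow> (\<forall>n. apply_bcontfun (S (chi B)) n = 0)"
      by (metis bcontfun_eqI zero_bcontfun.rep_eq)
    finally show ?thesis
      by (simp add: support_def)
  qed
qed

end

lemma lattice_isomorphic_imp_discrete_family:
  assumes I: "nat_ideal I" and "quot_lattice_isomorphic_linf I"
  shows "\<exists>p. discrete_ultrafilter_family I p"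
proof -
  obtain T where bij: "bij_betw T (quot I) UNIV" and linear: "quot_linear I T"
    and sup: "\<forall>X\<in>quot I. \<forall>Y\<in>quot I. T (quot_sup I X Y) = linf_sup (T X) (T Y)"
    using assms(2) unfolding quot_lattice_isomorphic_linf_def by (elim exE conjE)
  define S where "S x = T (c0_rel I `` {x})" for x
  have quotient: "quotient_operator I S"
    unfolding S_def by (rule quotient_operator_of_quot_linear[OF I bij linear])
  then have "S (- x) = - S x" for x
    by (simp add: quotient_operator_def linear_neg)
  moreover have "S (linf_sup x y) = linf_sup (S x) (S y)" for x y
    using sup quot_class quot_ops_class(3)[OF I] unfolding S_def by metis
  ultimately have "S (linf_abs x) = linf_abs (S x)" for x
    by (simp add: linf_abs_def)
  then have "abs_preserving_quotient I S"
    using I quotient by (intro abs_preserving_quotient.intro)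
  then show ?thesis
    using abs_preserving_quotient.discrete_family_support by blast
qed

section \<open>Isometries of the quotient\<close>

text \<open>An operator that reflects the order in both directions preserves absolute values, since
  the absolute value is the least upper bound of a sequence and its negative, and both bounds can be
  compared on either side.\<close>

lemma order_reflecting_imp_abs_preserving:
  assumes I: "nat_ideal I" and quotient: "quotient_operator I S"
    and order: "\<And>x. linf_nonneg (S x) \<longleftrightarrow> (\<forall>e>0. {n. apply_bcontfun x n \<le> - e} \<in> I)"
  shows "abs_preserving_quotient I S"
proof (rule abs_preserving_quotient.intro[OF I quotient], rule bcontfun_eqI, rule antisym)
  have linear: "linear S" and "surj S"
    using quotient by (auto simp: quotient_operator_def)
  fix x n
  obtain z where z: "S z = linf_abs (S x)"
    using \<open>surj S\<close> by (metis surjD)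
  have "linf_nonneg (S (z - x))" "linf_nonneg (S (z + x))"
    unfolding linear_diff[OF linear] linear_add[OF linear] z
    by (auto simp: linf_nonneg_def linf_abs_apply abs_real_def)
  then have small: "{n. apply_bcontfun (z - x) n \<le> - e} \<in> I"
      "{n. apply_bcontfun (z + x) n \<le> - e} \<in> I" if "0 < e" for e
    using that by (simp_all only: order)
  have "linf_nonneg (S (z - linf_abs x))"
    unfolding order
  proof (intro allI impI)
    fix e :: real assume "0 < e"
    have "{n. apply_bcontfun (z - linf_abs x) n \<le> - e} \<subseteq>
        {n. apply_bcontfun (z - x) n \<le> - e} \<union> {n. apply_bcontfun (z + x) n \<le> - e}"
      by (auto simp: linf_abs_apply)
    then show "{n. apply_bcontfun (z - linf_abs x) n \<le> - e} \<in> I"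
      using ideal_Un[OF I small[OF \<open>0 < e\<close>]] ideal_subset[OF I] by blast
  qed
  then show "apply_bcontfun (S (linf_abs x)) n \<le> apply_bcontfun (linf_abs (S x)) n"
    unfolding linear_diff[OF linear] z by (simp add: linf_nonneg_def)
  have "linf_nonneg (S (linf_abs x - x))" "linf_nonneg (S (linf_abs x + x))"
    unfolding order
    by (intro allI impI ideal_subset[OF I ideal_empty[OF I]]; force simp: linf_abs_apply)+
  then have "0 \<le> apply_bcontfun (S (linf_abs x - x)) n" "0 \<le> apply_bcontfun (S (linf_abs x + x)) n"
    unfolding linf_nonneg_def by blast+
  then show "apply_bcontfun (linf_abs (S x)) n \<le> apply_bcontfun (S (linf_abs x)) n"
    by (simp add: linear_diff[OF linear] linear_add[OF linear] linf_abs_apply abs_le_iff)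
qed

locale isometric_quotient =
  fixes I :: "nat set set" and S :: "linf \<Rightarrow> linf"
  assumes ideal: "nat_ideal I" and quotient: "quotient_operator I S"
    and isometric: "norm (S x) = quot_norm (c0_rel I `` {x})"
begin

lemma linear_S: "linear S"
  using quotient by (simp add: quotient_operator_def)

lemma norm_S_le: "norm (S x) \<le> norm x"
  unfolding isometric by (rule quot_norm_le) (simp add: c0_rel_def c0_zero[OF ideal])

lemma norm_S_le_iff:
  "0 \<le> b \<Longrightarrow> norm (S x) \<le> b \<longleftrightarrow> (\<forall>e>0. {n. b + e \<le> \<bar>apply_bcontfun x n\<bar>} \<in> I)"
  unfolding isometric by (rule quot_norm_le_iff[OF ideal])

text \<open>The unit is an extreme point of the unit ball of the quotient, and the extreme points of
  the unit ball of the bounded sequences are the sequences of signs. Concretely, if the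
  \<open>n\<close>-th value had modulus less than one, a multiple of the \<open>n\<close>-th unit vector could be
  added and subtracted within the unit ball; its preimage \<open>x\<close> then satisfies
  \<open>\<bar>1 + x\<bar> < 1 + e\<close> and \<open>\<bar>1 - x\<bar> < 1 + e\<close> outside a set of the ideal for every
  \<open>e > 0\<close>, and so vanishes in the quotient.\<close>

lemma abs_S_unit: "\<bar>apply_bcontfun (S (chi UNIV)) n\<bar> = 1"
proof (rule ccontr)
  let ?u = "S (chi UNIV)"
  assume "\<bar>apply_bcontfun ?u n\<bar> \<noteq> 1"
  have "norm (chi UNIV) \<le> 1"
    by (rule linf_norm_le) (simp add: chi_apply)
  then have u_le: "\<bar>apply_bcontfun ?u m\<bar> \<le> 1" for m
    using linf_abs_le_norm[of ?u m] norm_S_le[of "chi UNIV"] by simp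
  define d where "d = 1 - \<bar>apply_bcontfun ?u n\<bar>"
  have "0 < d"
    using u_le[of n] \<open>\<bar>apply_bcontfun ?u n\<bar> \<noteq> 1\<close> by (simp add: d_def)
  obtain x where x: "S x = d *\<^sub>R chi {n}"
    using quotient unfolding quotient_operator_def by (metis surjD)
  have "norm (S (chi UNIV + x)) \<le> 1" "norm (S (chi UNIV - x)) \<le> 1"
    unfolding linear_add[OF linear_S] linear_diff[OF linear_S] x
    by (intro linf_norm_le; use u_le \<open>0 < d\<close> in \<open>simp add: chi_apply indicator_def\<close>;
        use d_def in linarith)+
  then have small: "{k. 1 + e \<le> \<bar>apply_bcontfun (chi UNIV + x) k\<bar>} \<in> I"
      "{k. 1 + e \<le> \<bar>apply_bcontfun (chi UNIV - x) k\<bar>} \<in> I" if "0 < e" for e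
    using that norm_S_le_iff[of 1] by simp_all
  have "x \<in> c0 I"
    unfolding c0_def
  proof (intro CollectI allI impI)
    fix e :: real assume "0 < e"
    have "{k. e \<le> \<bar>apply_bcontfun x k\<bar>} \<subseteq> {k. 1 + e \<le> \<bar>apply_bcontfun (chi UNIV + x) k\<bar>} \<union>
        {k. 1 + e \<le> \<bar>apply_bcontfun (chi UNIV - x) k\<bar>}"
      by (auto simp: chi_apply)
    then show "{k. e \<le> \<bar>apply_bcontfun x k\<bar>} \<in> I"
      using ideal_Un[OF ideal small[OF \<open>0 < e\<close>]] ideal_subset[OF ideal] by blast
  qed
  then have "S x = 0"
    using quotient by (simp add: quotient_operator_def)
  then show False
    using \<open>0 < d\<close> by (simp add: x chi_eq_0_iff)
qed

text \<open>Multiplication by the sign sequence that is the image of the unit corrects the isometry to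
  one that sends the unit to the unit. As in the Banach-Stone theorem, such an isometry respects the
  order.\<close>

definition unital :: "linf \<Rightarrow> linf" where
  "unital x = Bcontfun (\<lambda>n. apply_bcontfun (S (chi UNIV)) n * apply_bcontfun (S x) n)"

lemma unital_apply:
  "apply_bcontfun (unital x) n = apply_bcontfun (S (chi UNIV)) n * apply_bcontfun (S x) n"
  unfolding unital_def
  by (rule Bcontfun_apply[of _ "norm (S x)"]) (simp add: abs_mult abs_S_unit linf_abs_le_norm)

lemma unit_square: "apply_bcontfun (S (chi UNIV)) n * apply_bcontfun (S (chi UNIV)) n = 1"
  using abs_S_unit[of n] by (metis abs_mult_self_eq mult_1)

lemma linear_unital: "linear unital"
  by (rule linearI; rule bcontfun_eqI)
    (simp_all add: unital_apply linear_add[OF linear_S] linear_cmul[OF linear_S] algebra_simps)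

lemma quotient_operator_unital: "quotient_operator I unital"
  unfolding quotient_operator_def
proof (intro conjI allI linear_unital)
  show "surj unital"
  proof (rule surjI)
    fix y :: linf
    define y' :: linf
      where "y' = Bcontfun (\<lambda>n. apply_bcontfun (S (chi UNIV)) n * apply_bcontfun y n)"
    have y': "apply_bcontfun y' n = apply_bcontfun (S (chi UNIV)) n * apply_bcontfun y n" for n
      unfolding y'_def
      by (rule Bcontfun_apply[of _ "norm y"]) (simp add: abs_mult abs_S_unit linf_abs_le_norm)
    have "S (inv S y') = y'"
      using quotient by (simp add: quotient_operator_def surj_f_inv_f)
    then show "unital (inv S y') = y"
      by (intro bcontfun_eqI) (simp add: unital_apply y' mult.assoc[symmetric] unit_square)
  qed
  have "unital x = 0 \<longleftrightarrow> S x = 0" for x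
  proof -
    have "apply_bcontfun (unital x) n = 0 \<longleftrightarrow> apply_bcontfun (S x) n = 0" for n
      using abs_S_unit[of n] by (auto simp: unital_apply)
    then show ?thesis
      by (metis bcontfun_eqI zero_bcontfun.rep_eq)
  qed
  then show "unital x = 0 \<longleftrightarrow> x \<in> c0 I" for x
    using quotient by (simp add: quotient_operator_def)
qed

lemma abs_unital: "\<bar>apply_bcontfun (unital x) n\<bar> = \<bar>apply_bcontfun (S x) n\<bar>"
  by (simp add: unital_apply abs_mult abs_S_unit)

lemma norm_unital: "norm (unital x) = norm (S x)"
  by (rule antisym; rule linf_norm_le) (metis abs_unital linf_abs_le_norm)+

lemma unital_unit: "unital (chi UNIV) = chi UNIV"
  by (rule bcontfun_eqI) (simp add: unital_apply unit_square chi_apply)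

text \<open>For a sequence of norm at most \<open>b\<close>, being positive means being within \<open>b\<close> of the
  constant \<open>b\<close>, and this is expressed by the norm alone.\<close>

lemma unital_nonneg_iff:
  "linf_nonneg (unital x) \<longleftrightarrow> (\<forall>e>0. {n. apply_bcontfun x n \<le> - e} \<in> I)"
proof -
  let ?b = "norm x"
  have x_le: "apply_bcontfun x n \<le> ?b" for n
    using linf_abs_le_norm[of x n] by simp
  have unital_le: "apply_bcontfun (unital x) n \<le> ?b" for n
    using linf_abs_le_norm[of "unital x" n] norm_unital[of x] norm_S_le[of x] by simp
  have "norm (?b *\<^sub>R chi UNIV - unital x) \<le> ?b \<longleftrightarrow> linf_nonneg (unital x)"
  proof
    assume le: "norm (?b *\<^sub>R chi UNIV - unital x) \<le> ?b"
    show "linf_nonneg (unital x)"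
      unfolding linf_nonneg_def
    proof
      fix n
      have "\<bar>apply_bcontfun (?b *\<^sub>R chi UNIV - unital x) n\<bar> \<le> ?b"
        using linf_abs_le_norm le by (rule order_trans)
      then show "0 \<le> apply_bcontfun (unital x) n"
        by (simp add: chi_apply)
    qed
  next
    assume "linf_nonneg (unital x)"
    then show "norm (?b *\<^sub>R chi UNIV - unital x) \<le> ?b"
      using unital_le by (intro linf_norm_le) (simp add: linf_nonneg_def chi_apply abs_le_iff)
  qed
  moreover have "norm (?b *\<^sub>R chi UNIV - unital x) = norm (S (?b *\<^sub>R chi UNIV - x))"
    unfolding norm_unital[symmetric] linear_diff[OF linear_unital] linear_cmul[OF linear_unital]
      unital_unit ..
  moreover have "{n. ?b + e \<le> \<bar>apply_bcontfun (?b *\<^sub>R chi UNIV - x) n\<bar>} =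
      {n. apply_bcontfun x n \<le> - e}" for e
    using x_le by (auto simp: chi_apply)
  ultimately show ?thesis
    using norm_S_le_iff[of ?b "?b *\<^sub>R chi UNIV - x"] by simp
qed

end

lemma isometric_imp_discrete_family:
  assumes I: "nat_ideal I" and "quot_isometric_linf I"
  shows "\<exists>p. discrete_ultrafilter_family I p"
proof -
  obtain T where bij: "bij_betw T (quot I) UNIV" and linear: "quot_linear I T"
    and norm: "\<forall>X\<in>quot I. norm (T X) = quot_norm X"
    using assms(2) unfolding quot_isometric_linf_def by (elim exE conjE)
  interpret isometric_quotient I "\<lambda>x. T (c0_rel I `` {x})"
    by (intro isometric_quotient.intro I quotient_operator_of_quot_linear[OF I bij linear]
        bspec[OF norm] quot_class)
  interpret abs_preserving_quotient I unital
    by (rule order_reflecting_imp_abs_preserving[OF I quotient_operator_unital unital_nonneg_iff])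
  show ?thesis
    using discrete_family_support by blast
qed

section \<open>The equivalence\<close>

theorem theorem6p11:
  fixes I :: "nat set set"
  assumes "nat_ideal I"
  shows "(K_space I homeomorphic_space beta_nat \<longleftrightarrow> quot_isometric_linf I) \<and>
         (quot_isometric_linf I \<longleftrightarrow> quot_lattice_isomorphic_linf I) \<and>
         (quot_lattice_isomorphic_linf I \<longleftrightarrow> strongly_omega_maximal I) \<and>
         (strongly_omega_maximal I \<longleftrightarrow> strongly_complemented I)"
proof (cases "\<exists>p. discrete_ultrafilter_family I p")
  case True
  then obtain q where "discrete_ultrafilter_family I q"
    by blast
  then obtain p c where "separated_ultrafilters I p c"
    by (rule discrete_family_imp_separated)
  then interpret separated_ultrafilters I p c .
  have "strongly_omega_maximal I"
    using True by (simp only: strongly_omega_maximal_iff[OF assms])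
  then show ?thesis
    using K_space_homeomorphic quot_isometric[OF assms] quot_lattice_isomorphic[OF assms]
      strongly_complemented by simp
next
  case False
  then show ?thesis
    using homeomorphic_imp_discrete_family[OF assms] isometric_imp_discrete_family[OF assms]
      lattice_isomorphic_imp_discrete_family[OF assms] strongly_omega_maximal_iff[OF assms]
      strongly_complemented_imp_discrete_family[OF assms] by blast
qed

end
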